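(* Let $q=p^e$ with $p$ a prime and $e\ge1$, let $r\ge 2$ and $m=2r$. Let $D=\{x\in\mathbb{F}_{q^m}:\mathrm{Tr}_{q^r/q}(x^{q^r+1})=0\}$ and $$\overline{\mathcal{C}_D}=\{(\mathrm{Tr}_{q^m/q}(bx)+c)_{x\in D}: b\in\mathbb{F}_{q^m},\ c\in\mathbb{F}_q\}.$$ Then $\overline{\mathcal{C}_D}$ is a $[q^{r-1}(q^r-q+1),\ m+1,\ q^{r-1}(q^r-q^{r-1}-q+1)]$ linear code over $\mathbb{F}_q$ whose weight distribution is: weight $0$ with frequency $1$; weight $q^{r-1}(q^r-q^{r-1}-q+1)$ with frequency $q^{r-1}(2q^{r+1}-2q^r-q^2+3q-2)-q+1$; weight $q^{r-1}(q^r-q^{r-1}-q+2)$ with frequency $q^{r-1}(q-1)(q^{r+1}-q^r+q-1)$; weight $q^{2r-2}(q-1)$ with frequency $q^{r-1}(q^r-q+1)-1$; weight $q^{r-1}(q^r-q+1)$ with frequency $q-1$. Moreover, writing $n=q^{r-1}(q^r-q+1)$: if $q>2$, then $\overline{\mathcal{C}_D}^{\perp}$ has parameters $[n,n-m-1,3]$ and is at least almost optimal according to the sphere-packing bound; if $q=2$ and $r>2$, then $\overline{\mathcal{C}_D}^{\perp}$ has parameters $[n,n-m-1,4]$ and is optimal according to the sphere-packing bound.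
   Context: $\mathrm{Tr}_{q^k/q}$ denotes the trace map from $\mathbb{F}_{q^k}$ to $\mathbb{F}_q$. Coordinates are indexed by the elements of $D$ in a fixed order. An $[n,k,d]$ code is optimal if no $[n,k,d+1]$ code over the same field exists, and almost optimal if an optimal $[n,k,d+1]$ code exists; "at least almost optimal according to the sphere-packing bound" means the sphere-packing bound $q^k\le q^n/\sum_{i=0}^{\lfloor (d'-1)/2\rfloor}\binom{n}{i}(q-1)^i$ rules out an $[n,k,d+2]$ code (so the code is optimal or almost optimal), and "optimal according to the sphere-packing bound" means the bound rules out an $[n,k,d+1]$ code. *)

theory Defs
  imports Complex_Main "HOL-Computational_Algebra.Primes"
begin

text \<open>Finite fields are modelled by a type of class field and finite.
  Inside a field of order q^m, the subfield F_q is the set of fixed points of x -> x^q.\<close>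

definition subfield_of_order :: "nat \<Rightarrow> 'a::field set" where
  "subfield_of_order q = {x. x ^ q = x}"

definition trace :: "nat \<Rightarrow> nat \<Rightarrow> 'a::field \<Rightarrow> 'a" where
  "trace q k x = (\<Sum>i<k. x ^ (q ^ i))"

definition vecs :: "'a::field set \<Rightarrow> 'b set \<Rightarrow> ('b \<Rightarrow> 'a) set" where
  "vecs F D = {v. (\<forall>x\<in>D. v x \<in> F) \<and> (\<forall>x. x \<notin> D \<longrightarrow> v x = 0)}"

definition hweight :: "'b set \<Rightarrow> ('b \<Rightarrow> 'a::field) \<Rightarrow> nat" where
  "hweight D v = card {x\<in>D. v x \<noteq> 0}"

definition is_linear_code :: "'a::field set \<Rightarrow> 'b set \<Rightarrow> ('b \<Rightarrow> 'a) set \<Rightarrow> bool" where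
  "is_linear_code F D C \<longleftrightarrow> C \<subseteq> vecs F D \<and> (\<lambda>_. 0) \<in> C
     \<and> (\<forall>u\<in>C. \<forall>v\<in>C. (\<lambda>x. u x + v x) \<in> C)
     \<and> (\<forall>a\<in>F. \<forall>u\<in>C. (\<lambda>x. a * u x) \<in> C)"

definition min_dist :: "'b set \<Rightarrow> ('b \<Rightarrow> 'a::field) set \<Rightarrow> nat" where
  "min_dist D C = Min {hweight D v | v. v \<in> C \<and> v \<noteq> (\<lambda>_. 0)}"

text \<open>C is an [n,k,d] linear code over F (with |F| = q).\<close>
definition code_params ::
  "'a::field set \<Rightarrow> nat \<Rightarrow> 'b set \<Rightarrow> ('b \<Rightarrow> 'a) set \<Rightarrow> nat \<Rightarrow> nat \<Rightarrow> nat \<Rightarrow> bool" where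
  "code_params F q D C n k d \<longleftrightarrow> is_linear_code F D C \<and> finite D \<and> card D = n
     \<and> card C = q ^ k \<and> min_dist D C = d"

definition dual_code :: "'a::field set \<Rightarrow> 'b set \<Rightarrow> ('b \<Rightarrow> 'a) set \<Rightarrow> ('b \<Rightarrow> 'a) set" where
  "dual_code F D C = {v \<in> vecs F D. \<forall>u\<in>C. (\<Sum>x\<in>D. u x * v x) = 0}"

definition sphere_packing_rules_out :: "nat \<Rightarrow> nat \<Rightarrow> nat \<Rightarrow> nat \<Rightarrow> bool" where
  "sphere_packing_rules_out q n k d' \<longleftrightarrow>
     \<not> (real q ^ k \<le> real q ^ n / (\<Sum>i\<le>(d' - 1) div 2. real (n choose i) * (real q - 1) ^ i))"

end

theory Submission
  imports Defs "HOL-Computational_Algebra.Polynomial" "HOL-Library.FuncSet"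
begin

text \<open>
  \<open>Q x = Tr(x ^ (q ^ r + 1))\<close> is a quadratic form over \<open>F\<^sub>q\<close> whose polar form is
  \<open>(a, x) \<mapsto> Tr(a ^ (q ^ r) * x)\<close>.  The fibre sizes of \<open>Q\<close> follow from those of the trace and the
  norm, which are forced because a polynomial has at most as many roots as its degree.  The weight
  of a codeword is governed by the number of zeros of \<open>Q\<close> on an affine hyperplane \<open>Tr(b * x) = t\<close>;
  for \<open>t = 0\<close> it is obtained by completing the square, and for \<open>t \<noteq> 0\<close> by scaling.  The dual code
  consists of the affine dependencies among the points of \<open>D\<close>, so its minimum distance is 3 if
  some three points of \<open>D\<close> are collinear (\<open>0, x, l * x\<close>), and for \<open>q = 2\<close> it is 4 as soon as \<open>Q\<close>
  has a totally singular plane \<open>{0, x, y, x + y}\<close>.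
\<close>

section \<open>Fibres of finite maps\<close>

lemma card_eq_sum_fibres:
  assumes "finite A" "finite B" "f ` A \<subseteq> B"
  shows "card A = (\<Sum>y\<in>B. card {x\<in>A. f x = y})"
  using sum.group[OF assms, of "\<lambda>_. 1::nat"] by simp

text \<open>The fibres add up to \<open>card A\<close>, so if the bounds \<open>c\<close> together
  do not exceed \<open>card A\<close>, no fibre can fall short. This turns root bounds for
  polynomials into exact fibre sizes.\<close>

lemma card_fibre_eq_bound:
  assumes "finite A" "finite B" "f ` A \<subseteq> B"
    and bound: "\<And>y. y \<in> B \<Longrightarrow> card {x\<in>A. f x = y} \<le> c"
    and large: "c * card B \<le> card A" and "y \<in> B"
  shows "card {x\<in>A. f x = y} = c"
proof (rule ccontr)
  assume "card {x\<in>A. f x = y} \<noteq> c"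
  with bound[OF \<open>y \<in> B\<close>] have "card {x\<in>A. f x = y} < c" by simp
  then have "(\<Sum>y\<in>B. card {x\<in>A. f x = y}) < (\<Sum>y\<in>B. c)"
    using assms by (intro sum_strict_mono_ex1) auto
  with card_eq_sum_fibres[OF assms(1-3)] large show False by (simp add: mult.commute)
qed

section \<open>Linear codes and duality over a finite subfield\<close>

locale finite_subfield =
  fixes F :: "'a::field set"
  assumes finite_F: "finite F"
    and one_F: "1 \<in> F"
    and diff_F: "x \<in> F \<Longrightarrow> y \<in> F \<Longrightarrow> x - y \<in> F"
    and mult_F: "x \<in> F \<Longrightarrow> y \<in> F \<Longrightarrow> x * y \<in> F"
    and inverse_F: "x \<in> F \<Longrightarrow> inverse x \<in> F"
begin

lemma zero_F: "0 \<in> F"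
  using diff_F[OF one_F one_F] by simp

lemma uminus_F: "x \<in> F \<Longrightarrow> - x \<in> F"
  using diff_F[OF zero_F] by fastforce

lemma add_F: "x \<in> F \<Longrightarrow> y \<in> F \<Longrightarrow> x + y \<in> F"
  using diff_F[OF _ uminus_F] by fastforce

lemma divide_F: "x \<in> F \<Longrightarrow> y \<in> F \<Longrightarrow> x / y \<in> F"
  by (simp add: divide_inverse mult_F inverse_F)

lemma sum_F: "(\<And>x. x \<in> A \<Longrightarrow> f x \<in> F) \<Longrightarrow> sum f A \<in> F"
  by (induction A rule: infinite_finite_induct) (auto simp: zero_F add_F)

lemma card_F_ge_2: "card F \<ge> 2"
  using card_mono[OF finite_F, of "{0, 1}"] zero_F one_F by simp

lemma is_linear_code_vecs: "is_linear_code F D (vecs F D)"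
  by (auto simp: is_linear_code_def vecs_def zero_F add_F mult_F)

lemma card_vecs:
  assumes "finite D"
  shows "finite (vecs F D)" "card (vecs F D) = card F ^ card D"
proof -
  have "bij_betw (\<lambda>v. restrict v D) (vecs F D) (D \<rightarrow>\<^sub>E F)"
    \<comment> \<open>Outside \<open>D\<close>, \<open>vecs\<close> pads with \<open>0\<close> and
      \<open>PiE\<close> with \<open>undefined\<close>; the two maps exchange the padding.\<close>
    by (rule bij_betw_byWitness[where f' = "\<lambda>v x. if x \<in> D then v x else 0"])
      (auto simp: vecs_def restrict_def fun_eq_iff PiE_def extensional_def)
  then show "finite (vecs F D)" "card (vecs F D) = card F ^ card D"
    using assms finite_F
    by (auto simp: bij_betw_same_card card_funcsetE finite_PiE bij_betw_finite)
qed

text \<open>Translation by a multiple of \<open>u0\<close> carries every fibre of the functional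
  \<open>g\<close> onto its kernel, so all values in \<open>F\<close> are taken equally often. The
  dual count applies this to both arguments of the pairing.\<close>

lemma card_kernel:
  assumes code: "is_linear_code F D S" and fin: "finite S"
    and g_F: "\<And>u. u \<in> S \<Longrightarrow> g u \<in> F"
    and g_add: "\<And>u v. u \<in> S \<Longrightarrow> v \<in> S \<Longrightarrow> g (\<lambda>x. u x + v x) = g u + g v"
    and g_scale: "\<And>a u. a \<in> F \<Longrightarrow> u \<in> S \<Longrightarrow> g (\<lambda>x. a * u x) = a * g u"
    and u0: "u0 \<in> S" "g u0 \<noteq> 0"
  shows "card F * card {u\<in>S. g u = 0} = card S"
proof -
  have S_add: "(\<lambda>x. u x + v x) \<in> S" if "u \<in> S" "v \<in> S" for u v
    using code that by (auto simp: is_linear_code_def)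
  have S_scale: "(\<lambda>x. a * u x) \<in> S" if "a \<in> F" "u \<in> S" for a u
    using code that by (auto simp: is_linear_code_def)
  have fibre: "card {u\<in>S. g u = y} = card {u\<in>S. g u = 0}" if y: "y \<in> F" for y
  proof -
    define t where "t = y / g u0"
    have t: "t \<in> F" "t * g u0 = y"
      using y u0 by (auto simp: t_def divide_F g_F)
    have tu0: "(\<lambda>x. a * u0 x) \<in> S" if "a \<in> F" for a
      using that u0 by (rule_tac S_scale)
    have "bij_betw (\<lambda>u x. u x + (-t) * u0 x) {u\<in>S. g u = y} {u\<in>S. g u = 0}"
    proof (rule bij_betw_byWitness[where f' = "\<lambda>u x. u x + t * u0 x"])
      show "(\<lambda>u x. u x + (-t) * u0 x) ` {u\<in>S. g u = y} \<subseteq> {u\<in>S. g u = 0}"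
        using S_add[OF _ tu0[OF uminus_F[OF t(1)]]] t u0
          g_add[OF _ tu0[OF uminus_F[OF t(1)]]] g_scale[OF uminus_F[OF t(1)] u0(1)] by auto
      show "(\<lambda>u x. u x + t * u0 x) ` {u\<in>S. g u = 0} \<subseteq> {u\<in>S. g u = y}"
        using S_add[OF _ tu0[OF t(1)]] t u0
          g_add[OF _ tu0[OF t(1)]] g_scale[OF t(1) u0(1)] by auto
    qed auto
    then show ?thesis by (rule bij_betw_same_card)
  qed
  have "card S = (\<Sum>y\<in>F. card {u\<in>S. g u = y})"
    using fin finite_F g_F by (intro card_eq_sum_fibres) auto
  also have "\<dots> = card F * card {u\<in>S. g u = 0}"
    by (simp add: fibre)
  finally show ?thesis by simp
qed

lemma is_linear_code_dual: "is_linear_code F D (dual_code F D C)"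
  by (auto simp: is_linear_code_def dual_code_def vecs_def zero_F add_F mult_F
      distrib_left sum.distrib sum_distrib_left[symmetric] mult.left_commute)

text \<open>Both sides count the pairs \<open>(u, v) \<in> C \<times> F\<^sup>D\<close> with \<open>\<langle>u, v\<rangle> = 0\<close>.\<close>

lemma card_dual_code:
  assumes D: "finite D" and code: "is_linear_code F D C"
  shows "card C * card (dual_code F D C) = card F ^ card D"
proof -
  define V where "V = vecs F D"
  define g where "g u v = (\<Sum>x\<in>D. u x * v x)" for u v :: "'b \<Rightarrow> 'a"
  define q where "q = card F"
  define W where "W = dual_code F D C"
  have V: "finite V" "card V = q ^ card D" "is_linear_code F D V"
    using card_vecs[OF D] is_linear_code_vecs by (auto simp: V_def q_def)
  have CV: "C \<subseteq> V" "(\<lambda>_. 0) \<in> C" using code by (auto simp: is_linear_code_def V_def)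
  then have "finite C" using V finite_subset by auto
  have WV: "W \<subseteq> V" by (auto simp: W_def V_def dual_code_def)
  have g_F: "g u v \<in> F" if "u \<in> V" "v \<in> V" for u v
    using that by (auto simp: g_def V_def vecs_def intro!: sum_F mult_F)
  \<comment> \<open>The unit vector at a coordinate where \<open>u\<close> is nonzero shows that
    pairing with \<open>u\<close> is a nonzero functional on \<open>V\<close>.\<close>
  have row: "q * card {v\<in>V. g u v = 0} = card V" if u: "u \<in> C" "u \<noteq> (\<lambda>_. 0)" for u
  proof -
    have "u \<in> V" using u CV by auto
    then obtain x0 where x0: "x0 \<in> D" "u x0 \<noteq> 0"
      using u by (auto simp: V_def vecs_def fun_eq_iff)
    define e where "e = (\<lambda>x. if x = x0 then 1 else 0 :: 'a)"
    have "g u e = (\<Sum>x\<in>D. if x = x0 then u x0 else 0)"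
      by (auto simp: g_def e_def intro!: sum.cong)
    then have "g u e \<noteq> 0" using x0 D by simp
    moreover have "e \<in> V" using x0 by (auto simp: e_def V_def vecs_def one_F zero_F)
    ultimately show ?thesis unfolding q_def
      using V g_F \<open>u \<in> V\<close>
      by (intro card_kernel[of D V _ e])
        (auto simp: g_def distrib_left sum.distrib sum_distrib_left mult.left_commute)
  qed
  have col: "q * card {u\<in>C. g u v = 0} = card C" if v: "v \<in> V - W" for v
  proof -
    obtain u0 where "u0 \<in> C" "g u0 v \<noteq> 0"
      using v by (auto simp: V_def W_def dual_code_def g_def)
    then show ?thesis unfolding q_def
      using \<open>finite C\<close> code g_F v CV
      by (intro card_kernel[of D C _ u0])
        (auto simp: g_def distrib_right sum.distrib sum_distrib_left mult.assoc)
  qed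
  have col0: "{u\<in>C. g u v = 0} = C" if "v \<in> W" for v
    using that by (auto simp: W_def dual_code_def g_def)
  have row0: "{v\<in>V. g (\<lambda>_. 0) v = 0} = V"
    by (auto simp: g_def)
  have "(\<Sum>u\<in>C. q * card {v\<in>V. g u v = 0})
      = q * card V + (\<Sum>u\<in>C - {\<lambda>_. 0}. q * card {v\<in>V. g u v = 0})"
    using \<open>finite C\<close> CV by (subst sum.remove[of _ "\<lambda>_. 0"]) (auto simp: row0)
  also have "(\<Sum>u\<in>C - {\<lambda>_. 0}. q * card {v\<in>V. g u v = 0}) = (card C - 1) * card V"
    using CV \<open>finite C\<close> by (simp add: row)
  finally have rows: "(\<Sum>u\<in>C. q * card {v\<in>V. g u v = 0}) = q * card V + (card C - 1) * card V" .
  have "(\<Sum>v\<in>V. q * card {u\<in>C. g u v = 0})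
      = (\<Sum>v\<in>W. q * card {u\<in>C. g u v = 0}) + (\<Sum>v\<in>V - W. q * card {u\<in>C. g u v = 0})"
    using V WV by (simp add: sum.subset_diff add.commute)
  also have "\<dots> = card W * (q * card C) + (card V - card W) * card C"
    using V WV by (simp add: col col0 card_Diff_subset finite_subset)
  finally have cols: "(\<Sum>v\<in>V. q * card {u\<in>C. g u v = 0})
      = card W * (q * card C) + (card V - card W) * card C" .
  have "(\<Sum>u\<in>C. card {v\<in>V. g u v = 0}) = (\<Sum>v\<in>V. card {u\<in>C. g u v = 0})"
    using sum_multicount_gen[of C V "\<lambda>u v. g u v = 0" "\<lambda>v. card {u\<in>C. g u v = 0}"] V \<open>finite C\<close> by simp
  then have eq: "q * card V + (card C - 1) * card V
      = card W * (q * card C) + (card V - card W) * card C"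
    unfolding rows[symmetric] cols[symmetric] sum_distrib_left[symmetric] by simp
  \<comment> \<open>These bounds make the truncated differences exact, so the identity can be moved
    to the integers, where it collapses to a multiple of \<open>int q - 1\<close>.\<close>
  have "card C \<ge> 1" using CV \<open>finite C\<close> by (metis One_nat_def Suc_leI card_gt_0_iff empty_iff)
  moreover have "card W \<le> card V" using V(1) WV by (rule card_mono)
  ultimately have "int q * int (card V) + (int (card C) - 1) * int (card V)
      = int (card W) * (int q * int (card C)) + (int (card V) - int (card W)) * int (card C)"
    using arg_cong[OF eq, of int] by (simp add: of_nat_diff)
  then have "(int q - 1) * int (card V) = (int q - 1) * (int (card C) * int (card W))"
    by (simp add: algebra_simps)
  moreover have "int q - 1 \<noteq> 0" using card_F_ge_2 by (simp add: q_def)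
  ultimately have "int (card V) = int (card C * card W)" by simp
  then show ?thesis using V by (simp only: of_nat_eq_iff) (simp add: W_def q_def)
qed

end

lemma min_dist_eqI:
  assumes "finite C" "u \<in> C" "u \<noteq> (\<lambda>_. 0)"
    and "\<And>v. v \<in> C \<Longrightarrow> v \<noteq> (\<lambda>_. 0) \<Longrightarrow> hweight D u \<le> hweight D v"
  shows "min_dist D C = hweight D u"
  unfolding min_dist_def using assms by (intro Min_eqI) auto

text \<open>Distance 5 means balls of radius 2. By \<open>large\<close>, the quadratic term of the
  ball volume alone reaches \<open>q ^ l\<close>, where \<open>l\<close> is the codimension; the
  centre of the ball makes the inequality strict.\<close>

lemma sphere_packing_rules_out_5:
  fixes q n l :: nat
  assumes "q \<ge> 2" "l \<le> n" and large: "2 * int q ^ l \<le> int n * (int n - 1) * (int q - 1)\<^sup>2"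
  shows "sphere_packing_rules_out q n (n - l) 5"
proof -
  define S where "S = (\<Sum>i\<le>2. real (n choose i) * (real q - 1) ^ i)"
  have "2 * (n choose 2) = n * (n - 1)"
    by (cases n) (simp_all add: choose_two)
  then have "real (2 * (n choose 2)) = real (n * (n - 1))" by (simp only:)
  also have "\<dots> = real n * (real n - 1)" by (cases n) (simp_all add: algebra_simps)
  finally have "2 * real (n choose 2) = real n * (real n - 1)" by simp
  then have "2 * S = 2 + 2 * real n * (real q - 1) + real n * (real n - 1) * (real q - 1)\<^sup>2"
    by (simp add: S_def numeral_2_eq_2 distrib_left flip: mult.assoc)
  moreover have "2 * real q ^ l \<le> real n * (real n - 1) * (real q - 1)\<^sup>2"
    using of_int_le_iff[where 'a = real, THEN iffD2, OF large] by simp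
  moreover have "real n * (real q - 1) \<ge> 0" using assms(1) by simp
  ultimately have S: "real q ^ l < S" by linarith
  have "real q ^ n = real q ^ (n - l) * real q ^ l"
    using assms(2) by (simp flip: power_add)
  with S have "real q ^ n < real q ^ (n - l) * S" using assms(1) by simp
  moreover have "S > 0" using S assms(1) by (intro order.strict_trans[OF _ S]) simp
  ultimately have "real q ^ n / S < real q ^ (n - l)"
    by (simp add: pos_divide_less_eq)
  then show ?thesis by (simp add: sphere_packing_rules_out_def S_def)
qed

section \<open>Trace and norm fibres in a finite field\<close>

lemma card_trace_fibre_le:
  fixes y :: "'a::field"
  assumes "k \<ge> 1" "q \<ge> 2"
  shows "card {x. trace q k x = y} \<le> q ^ (k - 1)"
proof -
  define P where "P = (\<Sum>i<k. monom (1::'a) (q ^ i)) - [:y:]"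
  have "{i \<in> {..<k}. q ^ i = q ^ (k - 1)} = {k - 1}"
    using assms by (auto simp: power_inject_exp)
  \<comment> \<open>The exponents \<open>q ^ i\<close> are distinct and positive, so neither another
    monomial nor the constant \<open>y\<close> disturbs the leading coefficient, which is therefore
    1.\<close>
  moreover have "coeff P (q ^ (k - 1)) = (\<Sum>i<k. if q ^ i = q ^ (k - 1) then 1 else 0)"
    using assms by (auto simp: P_def coeff_sum coeff_pCons split: nat.splits)
  ultimately have "coeff P (q ^ (k - 1)) = 1"
    by (simp add: sum.If_cases Int_def)
  then have "P \<noteq> 0" by auto
  have "degree P \<le> q ^ (k - 1)" unfolding P_def
    by (intro degree_diff_le degree_sum_le)
      (use assms in \<open>auto intro!: order.trans[OF degree_monom_le] power_increasing\<close>)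
  moreover have "{x. trace q k x = y} = {x. poly P x = 0}"
    by (auto simp: P_def trace_def poly_sum poly_monom)
  ultimately show ?thesis using card_poly_roots_bound[OF \<open>P \<noteq> 0\<close>] by simp
qed

lemma card_power_fibre_le:
  fixes y :: "'a::field"
  assumes "k \<ge> 1"
  shows "card {x. x ^ k = y} \<le> k"
proof -
  define P where "P = monom (1::'a) k - [:y:]"
  have "coeff P k = 1" using assms by (auto simp: P_def coeff_pCons split: nat.splits)
  then have "P \<noteq> 0" by auto
  moreover have "degree P \<le> k" unfolding P_def
    by (intro degree_diff_le) (auto simp: degree_monom_le)
  moreover have "{x. x ^ k = y} = {x. poly P x = 0}"
    by (auto simp: P_def poly_monom)
  ultimately show ?thesis using card_poly_roots_bound[OF \<open>P \<noteq> 0\<close>] by simp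
qed

lemma card_subfield_of_order_le:
  assumes "q \<ge> 2"
  shows "card (subfield_of_order q :: 'a::field set) \<le> q"
proof -
  define P where "P = monom (1::'a) q - monom 1 1"
  have "coeff P q = 1" using assms by (auto simp: P_def)
  then have "P \<noteq> 0" by auto
  moreover have "degree P \<le> q" unfolding P_def
    using assms by (intro degree_diff_le) (auto simp: degree_monom_le degree_monom_eq)
  moreover have "subfield_of_order q = {x. poly P x = 0}"
    by (auto simp: P_def poly_monom subfield_of_order_def)
  ultimately show ?thesis using card_poly_roots_bound[OF \<open>P \<noteq> 0\<close>] by simp
qed

text \<open>Multiplication by a nonzero \<open>x\<close> permutes the nonzero elements; comparing
  their products gives the exponent.\<close>

lemma power_card_UNIV_eq:
  fixes x :: "'a::{field,finite}"
  shows "x ^ card (UNIV :: 'a set) = x"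
proof (cases "x = 0")
  case False
  have "(\<Prod>y\<in>UNIV - {0}. x * y) = \<Prod>(UNIV - {0})"
    by (rule prod.reindex_bij_witness[of _ "\<lambda>y. y / x" "\<lambda>y. x * y"]) (use False in auto)
  then have "x ^ (card (UNIV :: 'a set) - 1) = 1"
    by (simp add: prod.distrib)
  moreover have "card (UNIV :: 'a set) = Suc (card (UNIV :: 'a set) - 1)"
    using finite_UNIV_card_ge_0[where ?'a = 'a] by simp
  ultimately show ?thesis by (metis mult.right_neutral power_Suc)
qed (use finite_UNIV_card_ge_0[where ?'a = 'a] in auto)

text \<open>Translation by 1 preserves the sum of all elements, so \<open>p ^ k\<close> vanishes in
  the field and the characteristic, being prime, divides it.\<close>

lemma CHAR_eq_prime_of_card:
  assumes "prime p" and "card (UNIV :: 'a::{field,finite} set) = p ^ k"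
  shows "CHAR('a) = p"
proof -
  have "prime CHAR('a)"
    by (rule prime_CHAR_semidom) (auto intro: finite_imp_CHAR_pos)
  moreover have "CHAR('a) dvd p ^ k"
  proof -
    have "(\<Sum>x\<in>UNIV. x + 1 :: 'a) = (\<Sum>x\<in>UNIV. x)"
      by (rule sum.reindex_bij_witness[of _ "\<lambda>x. x - 1" "\<lambda>x. x + 1"]) auto
    then have "of_nat (p ^ k) = (0 :: 'a)"
      by (simp only: sum.distrib sum_constant assms(2)) simp
    then show ?thesis by (simp only: of_nat_eq_0_iff_char_dvd)
  qed
  ultimately show ?thesis
    using assms(1) prime_dvd_power primes_dvd_imp_eq by blast
qed

text \<open>The argument \<open>ty\<close> carries the type, so that the same field can be regarded
  as an extension of two different subfields.\<close>

locale finite_field_extension =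
  fixes q m :: nat and ty :: "'a::{field,finite} itself"
  assumes primepow: "\<exists>p e. prime p \<and> e \<ge> 1 \<and> q = p ^ e"
    and m_ge_1: "m \<ge> 1"
    and card_UNIV: "card (UNIV :: 'a set) = q ^ m"
begin

abbreviation F :: "'a set" where "F \<equiv> subfield_of_order q"

lemma q_ge_2: "q \<ge> 2"
proof -
  obtain p e where "prime p" "e \<ge> 1" "q = p ^ e" using primepow by blast
  then show ?thesis
    using prime_ge_2_nat[of p] self_le_power[of p e] by auto
qed

lemma power_q_power_m: "(x::'a) ^ (q ^ m) = x"
  using power_card_UNIV_eq[of x] card_UNIV by simp

lemma
  shows frobenius_add: "(x + y :: 'a) ^ (q ^ i) = x ^ (q ^ i) + y ^ (q ^ i)"
    and frobenius_sum: "(sum f A :: 'a) ^ (q ^ i) = (\<Sum>j\<in>A. f j ^ (q ^ i))"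
proof -
  obtain p e where pe: "prime p" "q = p ^ e" using primepow by blast
  then have "CHAR('a) = p"
    using card_UNIV CHAR_eq_prime_of_card[of p "e * m"] by (simp add: power_mult)
  then have "prime CHAR('a)" "q ^ i = CHAR('a) ^ (e * i)"
    using pe by (simp_all add: power_mult)
  then show "(x + y :: 'a) ^ (q ^ i) = x ^ (q ^ i) + y ^ (q ^ i)"
    "(sum f A :: 'a) ^ (q ^ i) = (\<Sum>j\<in>A. f j ^ (q ^ i))"
    by (rule freshmans_dream', rule freshmans_dream_sum')
qed

lemma power_q_power_of_mem_F: "x \<in> F \<Longrightarrow> x ^ (q ^ i) = x"
  by (induction i) (auto simp: subfield_of_order_def power_mult)

sublocale finite_subfield F
proof
  \<comment> \<open>Additivity of the Frobenius map settles the sign without a case distinction on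
    the parity of \<open>q\<close>.\<close>
  have minus: "(- y) ^ q = - (y ^ q)" for y :: 'a
    using frobenius_add[of y "- y" 1] q_ge_2 by (simp add: power_0_left eq_neg_iff_add_eq_0 add.commute)
  show "x - y \<in> F" if "x \<in> F" "y \<in> F" for x y
    using that frobenius_add[of x "- y" 1] minus[of y] by (simp add: subfield_of_order_def)
qed (auto simp: subfield_of_order_def power_mult_distrib power_inverse)

lemma trace_add: "trace q k (x + y :: 'a) = trace q k x + trace q k y"
  by (simp add: trace_def frobenius_add sum.distrib)

lemma trace_scale: "a \<in> F \<Longrightarrow> trace q k (a * x) = a * trace q k x"
  by (simp add: trace_def power_mult_distrib power_q_power_of_mem_F sum_distrib_left)

text \<open>Raising to the power \<open>q\<close> shifts the summands by one place, and the new last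
  term \<open>x ^ (q ^ k)\<close> is the lost first term \<open>x\<close>.\<close>

lemma trace_in_F:
  assumes "(x::'a) ^ (q ^ k) = x" and "k \<ge> 1"
  shows "trace q k x \<in> F"
proof -
  have "trace q k x ^ q = (\<Sum>i<k. (x ^ (q ^ i)) ^ q)"
    using frobenius_sum[of "\<lambda>i. x ^ (q ^ i)" "{..<k}" 1] by (simp add: trace_def)
  also have "\<dots> = (\<Sum>i<k. x ^ (q ^ Suc i))"
    by (simp add: power_mult[symmetric] mult.commute)
  also have "\<dots> = (\<Sum>i<Suc k. x ^ (q ^ i)) - x"
    by (subst sum.lessThan_Suc_shift) simp
  also have "\<dots> = trace q k x"
    using assms by (simp add: trace_def)
  finally show ?thesis by (simp add: subfield_of_order_def)
qed

text \<open>The root bound gives at most \<open>q\<close> elements. Conversely, the trace maps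
  \<open>q ^ m\<close> elements into \<open>F\<close> with fibres of size at most
  \<open>q ^ (m - 1)\<close>, which forces at least \<open>q\<close>.\<close>

lemma card_F: "card F = q"
proof -
  have "q ^ m = (\<Sum>y\<in>F. card {x\<in>UNIV. trace q m x = y})"
    using card_eq_sum_fibres[of "UNIV :: 'a set" F "trace q m"] finite_F
      trace_in_F[OF power_q_power_m m_ge_1] card_UNIV by auto
  also have "\<dots> \<le> (\<Sum>y\<in>F. q ^ (m - 1))"
    using card_trace_fibre_le[OF m_ge_1 q_ge_2] by (intro sum_mono) simp
  also have "\<dots> = card F * q ^ (m - 1)" by simp
  finally have "q * q ^ (m - 1) \<le> card F * q ^ (m - 1)"
    using m_ge_1 power_minus_mult[of m q] by (simp add: mult.commute)
  then have "q \<le> card F" using q_ge_2 by simp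
  with card_subfield_of_order_le[OF q_ge_2, where 'a = 'a] show ?thesis by simp
qed

end

section \<open>The quadric defined by the trace of the norm\<close>

locale trace_norm_quadric =
  finite_field_extension q "2 * r" ty for q r and ty :: "'a::{field,finite} itself" +
  assumes r_ge_2: "r \<ge> 2"
begin

text \<open>The ambient field is also a quadratic extension of the intermediate field
  \<open>K.F\<close> of order \<open>q ^ r\<close>, the target of the norm.\<close>

sublocale K: finite_field_extension "q ^ r" 2 ty
proof
  obtain p e where "prime p" "e \<ge> 1" "q = p ^ e" using primepow by blast
  then have "prime p" "e * r \<ge> 1" "q ^ r = p ^ (e * r)"
    using r_ge_2 by (auto simp: power_mult)
  then show "\<exists>p e. prime p \<and> e \<ge> 1 \<and> q ^ r = p ^ e" by blast
qed (auto simp: card_UNIV mult.commute power_mult[symmetric])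

section \<open>The quadratic form, its polar form and the sizes of their fibres\<close>

definition Q :: "'a \<Rightarrow> 'a" where "Q x = trace q r (x ^ (q ^ r + 1))"

definition T :: "'a \<Rightarrow> 'a \<Rightarrow> 'a" where "T b x = trace q (2 * r) (b * x)"

lemma power_q_r_twice: "((x::'a) ^ (q ^ r)) ^ (q ^ r) = x"
  using power_q_power_m[of x] by (simp add: power_mult[symmetric] power_add[symmetric] mult_2)

lemma mem_K_iff: "x \<in> K.F \<longleftrightarrow> x ^ (q ^ r) = x"
  by (simp add: subfield_of_order_def)

lemma norm_in_K: "x ^ (q ^ r + 1) \<in> K.F"
  by (simp add: mem_K_iff power_mult_distrib power_q_r_twice)

lemma Q_in_F: "Q x \<in> F"
  unfolding Q_def using norm_in_K r_ge_2 by (intro trace_in_F) (auto simp: mem_K_iff)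

lemma T_in_F: "T b x \<in> F"
  unfolding T_def using power_q_power_m r_ge_2 by (intro trace_in_F) auto

lemma Q_0 [simp]: "Q 0 = 0"
  using q_ge_2 by (simp add: Q_def trace_def power_0_left)

lemma Q_scale: "a \<in> F \<Longrightarrow> Q (a * x) = a\<^sup>2 * Q x"
proof -
  assume a: "a \<in> F"
  have "(a * x) ^ (q ^ r + 1) = a\<^sup>2 * x ^ (q ^ r + 1)"
    using power_q_power_of_mem_F[OF a, of r] by (simp add: power_mult_distrib power2_eq_square)
  then show ?thesis
    using trace_scale[OF mult_F[OF a a]] by (simp only: Q_def power2_eq_square)
qed

lemma T_scale: "a \<in> F \<Longrightarrow> T b (a * x) = a * T b x"
  using trace_scale[of a "2 * r" "b * x"] by (simp add: T_def mult.left_commute)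

lemma T_0 [simp]: "T 0 x = 0" "T b 0 = 0"
  using q_ge_2 by (simp_all add: T_def trace_def power_0_left)

lemma T_add_left: "T (a + b) x = T a x + T b x"
  by (simp add: T_def distrib_right trace_add)

lemma T_add_right: "T b (x + y) = T b x + T b y"
  by (simp add: T_def distrib_left trace_add)

lemma T_scale_left: "a \<in> F \<Longrightarrow> T (a * b) x = a * T b x"
  using trace_scale[of a "2 * r" "b * x"] by (simp add: T_def mult.assoc)

lemma T_sum: "T b (sum f A) = (\<Sum>i\<in>A. T b (f i))"
  by (induction A rule: infinite_finite_induct) (auto simp: T_add_right)

lemma Q_power_q_r: "Q (x ^ (q ^ r)) = Q x"
proof -
  have "(x ^ (q ^ r)) ^ (q ^ r + 1) = (x ^ (q ^ r + 1)) ^ (q ^ r)"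
    by (simp only: power_mult[symmetric] mult.commute)
  then show ?thesis using norm_in_K[of x] by (simp only: Q_def mem_K_iff)
qed

text \<open>Transitivity of the trace: the second half of the sum is the trace of the conjugate of
  \<open>x\<close>.\<close>

lemma trace_2r: "trace q (2 * r) (x::'a) = trace q r (x + x ^ (q ^ r))"
proof -
  have "trace q (2 * r) x = (\<Sum>i<r. x ^ (q ^ i)) + (\<Sum>i<r. x ^ (q ^ (r + i)))"
  proof -
    have split: "(\<Sum>i<k + l. f i) = (\<Sum>i<k. f i) + (\<Sum>i<l. f (k + i))" for k l and f :: "nat \<Rightarrow> 'a"
      by (induction l) (simp_all add: add.assoc)
    show ?thesis unfolding trace_def mult_2 by (rule split)
  qed
  also have "(\<Sum>i<r. x ^ (q ^ (r + i))) = trace q r (x ^ (q ^ r))"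
    by (simp add: trace_def power_mult[symmetric] power_add)
  finally show ?thesis by (simp only: trace_add trace_def[of q r x])
qed

text \<open>Expanding the norm, the cross term is \<open>z\<close> times the relative trace of
  \<open>b * x\<close>, which \<open>trace_2r\<close> turns into \<open>T b x\<close>. Shifting by
  the conjugate of \<open>b\<close> makes \<open>T b\<close> itself appear, and conjugation does not
  change \<open>Q b\<close>.\<close>

lemma Q_add:
  assumes z: "z \<in> F"
  shows "Q (x + z * b ^ (q ^ r)) = Q x + z * T b x + z\<^sup>2 * Q b"
proof -
  define a where "a = b ^ (q ^ r)"
  have zK: "z ^ (q ^ r) = z" using power_q_power_of_mem_F[OF z] .
  have ab: "a ^ (q ^ r) = b" by (simp add: a_def power_q_r_twice)
  have "(x + z * a) ^ (q ^ r + 1) = (x ^ (q ^ r) + z * b) * (x + z * a)"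
    using frobenius_add[of x "z * a" r] by (simp add: power_mult_distrib zK ab)
  also have "\<dots> = x ^ (q ^ r + 1) + (z * (b * x + (b * x) ^ (q ^ r)) + z\<^sup>2 * a ^ (q ^ r + 1))"
    by (simp add: ab power_mult_distrib) (simp add: a_def algebra_simps power2_eq_square)
  finally have "Q (x + z * a) = Q x + (trace q r (z * (b * x + (b * x) ^ (q ^ r)))
      + trace q r (z\<^sup>2 * a ^ (q ^ r + 1)))"
    by (simp only: Q_def trace_add)
  also have "\<dots> = Q x + z * T b x + z\<^sup>2 * Q a"
    using trace_scale[OF z] trace_scale[OF mult_F[OF z z]] 
    by (simp add: T_def Q_def trace_2r power2_eq_square)
  finally show ?thesis by (simp add: a_def Q_power_q_r)
qed

text \<open>The \<open>q ^ (2 * r) - 1\<close> nonzero elements map to \<open>q ^ r - 1\<close>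
  nonzero values, with at most \<open>q ^ r + 1\<close> roots over each; the product matches
  exactly.\<close>

lemma card_norm_fibre:
  assumes "y \<in> K.F" "y \<noteq> 0"
  shows "card {x. x ^ (q ^ r + 1) = y} = q ^ r + 1"
proof -
  have "card {x \<in> UNIV - {0}. x ^ (q ^ r + 1) = y} = q ^ r + 1"
  proof (rule card_fibre_eq_bound[where B = "K.F - {0}"])
    have "(q ^ r + 1) * card (K.F - {0}) = (q ^ r + 1) * (q ^ r - 1)"
      using K.card_F K.zero_F K.finite_F by simp
    also have "\<dots> = q ^ (2 * r) - 1"
      unfolding mult_2 power_add by (simp add: algebra_simps)
    finally show "(q ^ r + 1) * card (K.F - {0}) \<le> card (UNIV - {0 :: 'a})"
      using card_UNIV by (simp add: card_Diff_subset)
    show "card {x \<in> UNIV - {0}. x ^ (q ^ r + 1) = z} \<le> q ^ r + 1" for z :: 'a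
      by (rule order.trans[OF card_mono card_power_fibre_le[of "q ^ r + 1" z]]) auto
  qed (use assms norm_in_K in auto)
  moreover have "{x \<in> UNIV - {0}. x ^ (q ^ r + 1) = y} = {x. x ^ (q ^ r + 1) = y}"
    using assms by (auto simp: power_0_left)
  ultimately show ?thesis by simp
qed

lemma card_K_trace_fibre:
  assumes "u \<in> F"
  shows "card {y \<in> K.F. trace q r y = u} = q ^ (r - 1)"
proof (rule card_fibre_eq_bound[where B = F])
  show "q ^ (r - 1) * card F \<le> card K.F"
    using r_ge_2 power_minus_mult[of r q] by (simp add: card_F K.card_F)
  show "card {x \<in> K.F. trace q r x = y} \<le> q ^ (r - 1)" for y :: 'a
    using r_ge_2 q_ge_2
    by (intro order.trans[OF card_mono card_trace_fibre_le[of r q y]]) auto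
  show "trace q r ` K.F \<subseteq> F"
    using trace_in_F r_ge_2 by (auto simp: mem_K_iff)
qed (use assms in auto)

lemma card_T_fibre:
  assumes "b \<noteq> 0" "u \<in> F"
  shows "card {x. T b x = u} = q ^ (2 * r - 1)"
proof -
  have "card {x \<in> UNIV. T b x = u} = q ^ (2 * r - 1)"
  proof (rule card_fibre_eq_bound[where B = F])
    show "q ^ (2 * r - 1) * card F \<le> card (UNIV :: 'a set)"
      using r_ge_2 power_minus_mult[of "2 * r" q] by (simp add: card_F card_UNIV)
    show "card {x \<in> UNIV. T b x = y} \<le> q ^ (2 * r - 1)" for y :: 'a
    proof -
      \<comment> \<open>Multiplication by \<open>b\<close> is a permutation, so only fibres of the
        plain trace matter.\<close>
      have "card {x \<in> UNIV. T b x = y} = card {x. trace q (2 * r) x = y}"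
        using assms(1)
        by (intro bij_betw_same_card[of "\<lambda>x. b * x"] bij_betw_byWitness[where f' = "\<lambda>x. x / b"])
          (auto simp: T_def)
      also have "\<dots> \<le> q ^ (2 * r - 1)"
        using r_ge_2 q_ge_2 by (intro card_trace_fibre_le) auto
      finally show ?thesis .
    qed
  qed (use assms T_in_F in auto)
  then show ?thesis by simp
qed

text \<open>\<open>Q\<close> is the norm followed by the trace from \<open>K.F\<close>. The value 0
  is set aside in \<open>A\<close> and \<open>B\<close> because its norm fibre is only
  \<open>{0}\<close>; this explains the separate formula for \<open>u = 0\<close>.\<close>

lemma card_Q_fibre:
  assumes "u \<in> F"
  shows "card {x. Q x = u} =
    (if u = 0 then 1 + (q ^ r + 1) * (q ^ (r - 1) - 1) else (q ^ r + 1) * q ^ (r - 1))"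
proof -
  define A where "A = {x. Q x = u} - {0}"
  define B where "B = {y \<in> K.F. trace q r y = u} - {0}"
  have "card A = (\<Sum>y\<in>B. card {x \<in> A. x ^ (q ^ r + 1) = y})"
    by (rule card_eq_sum_fibres) (use norm_in_K in \<open>auto simp: A_def B_def Q_def\<close>)
  also have "\<dots> = (\<Sum>y\<in>B. q ^ r + 1)"
  proof (intro sum.cong refl)
    fix y assume "y \<in> B"
    then have y: "y \<in> K.F" "y \<noteq> 0" "trace q r y = u" by (auto simp: B_def)
    then have "{x \<in> A. x ^ (q ^ r + 1) = y} = {x. x ^ (q ^ r + 1) = y}"
      by (auto simp: A_def Q_def power_0_left)
    then show "card {x \<in> A. x ^ (q ^ r + 1) = y} = q ^ r + 1"
      using card_norm_fibre y by simp
  qed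
  finally have A: "card A = (q ^ r + 1) * card B" by (simp add: mult.commute)
  show ?thesis
  proof (cases "u = 0")
    case True
    have "trace q r 0 = (0::'a)" using q_ge_2 by (simp add: trace_def power_0_left)
    then have "card B = q ^ (r - 1) - 1"
      using card_K_trace_fibre[OF assms] True K.zero_F by (simp add: B_def card_Diff_singleton)
    moreover have "card {x. Q x = u} = card (insert 0 A)"
      using True by (intro arg_cong[of _ _ card]) (auto simp: A_def)
    moreover have "card (insert 0 A) = Suc (card A)"
      by (rule card_insert_disjoint) (auto simp: A_def)
    ultimately show ?thesis using A True by simp
  next
    case False
    moreover have "trace q r 0 = (0::'a)" using q_ge_2 by (simp add: trace_def power_0_left)
    ultimately have "B = {y \<in> K.F. trace q r y = u}" "A = {x. Q x = u}"
      by (auto simp: A_def B_def)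
    then show ?thesis using card_K_trace_fibre[OF assms] A False by simp
  qed
qed

section \<open>The zero set of the form and its hyperplane sections\<close>

definition D :: "'a set" where "D = {x. Q x = 0}"

text \<open>In terms of \<open>q\<close> and the integer \<open>X\<close> all counts become
  polynomials, free of truncated subtraction.\<close>

abbreviation X :: int where "X \<equiv> int q ^ (r - 1)"

lemma
  shows X_ge: "X \<ge> int q"
    and q_power_r: "int q ^ r = int q * X"
    and q_power_2r1: "int q ^ (2 * r - 1) = int q * X\<^sup>2"
    and q_power_2r2: "int q ^ (2 * r - 2) = X\<^sup>2"
    and q_power_2r: "int q ^ (2 * r) = (int q)\<^sup>2 * X\<^sup>2"
proof -
  obtain s where s: "r = Suc (Suc s)" using r_ge_2 by (metis Suc_le_D numeral_2_eq_2 Suc_le_mono)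
  show "X \<ge> int q" using q_ge_2 self_le_power[of "int q" "r - 1"] r_ge_2 by simp
  show "int q ^ r = int q * X" "int q ^ (2 * r - 1) = int q * X\<^sup>2" "int q ^ (2 * r - 2) = X\<^sup>2"
    "int q ^ (2 * r) = (int q)\<^sup>2 * X\<^sup>2"
    by (simp_all add: s power2_eq_square power_add mult_2)
qed

lemma int_card_Q_fibre:
  assumes "u \<in> F"
  shows "int (card {x. Q x = u}) = (if u = 0 then int q * X\<^sup>2 - int q * X + X else int q * X\<^sup>2 + X)"
proof -
  have "q ^ (r - 1) \<ge> 1" using q_ge_2 by simp
  then have "int (q ^ (r - 1) - 1) = X - 1" by (simp add: of_nat_diff)
  then show ?thesis
    unfolding card_Q_fibre[OF assms]
    by (simp add: q_power_r) (simp add: algebra_simps power2_eq_square)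
qed

lemma int_card_D: "int (card D) = int q * X\<^sup>2 - int q * X + X"
  using int_card_Q_fibre[OF zero_F] by (simp add: D_def)

text \<open>Count the pairs \<open>(x, z)\<close> with \<open>z \<in> F\<close> and \<open>Q x + z * T b x = 0\<close>.  For fixed \<open>z\<close> the
  condition reads \<open>Q (x + z * a) = z\<^sup>2 * Q b\<close> with \<open>a = b ^ (q ^ r)\<close>, so only the
  fibre sizes of \<open>Q\<close> enter.\<close>

lemma card_D_hyperplane_0:
  assumes b: "b \<noteq> 0"
  shows "int (card {x\<in>D. T b x = 0}) = (if b \<in> D then X\<^sup>2 - int q * X + X else X\<^sup>2)"
proof -
  define a where "a = b ^ (q ^ r)"
  define N where "N = card {x\<in>D. T b x = 0}"
  \<comment> \<open>For given \<open>x\<close> the equation is affine in \<open>z\<close>: one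
    solution if \<open>T b x\<close> is nonzero, otherwise all of \<open>F\<close> or nothing
    according to \<open>Q x\<close>.\<close>
  have "(\<Sum>x\<in>UNIV. card {z\<in>F. Q x + z * T b x = 0})
      = (\<Sum>x\<in>UNIV. of_bool (T b x \<noteq> 0) + q * of_bool (Q x = 0 \<and> T b x = 0))"
  proof (intro sum.cong refl)
    fix x
    show "card {z\<in>F. Q x + z * T b x = 0}
        = of_bool (T b x \<noteq> 0) + q * of_bool (Q x = 0 \<and> T b x = 0)"
    proof (cases "T b x = 0")
      case True
      then show ?thesis using card_F by (cases "Q x = 0") auto
    next
      case False
      then have "Q x + z * T b x = 0 \<longleftrightarrow> z = - (Q x / T b x)" for z
        by (simp add: eq_neg_iff_add_eq_0 add_divide_eq_iff add.commute)
      then have "{z\<in>F. Q x + z * T b x = 0} = {- (Q x / T b x)}"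
        using Q_in_F T_in_F by (auto simp: uminus_F divide_F)
      with False show ?thesis by simp
    qed
  qed
  also have "\<dots> = card {x. T b x \<noteq> 0} + q * N"
    by (simp add: sum.distrib sum_distrib_left[symmetric] N_def D_def)
  finally have by_x: "(\<Sum>x\<in>UNIV. card {z\<in>F. Q x + z * T b x = 0}) = card {x. T b x \<noteq> 0} + q * N" .
  have fibre: "card {x. Q x + z * T b x = 0} = card {x. Q x = z\<^sup>2 * Q b}" if "z \<in> F" for z
  proof (rule bij_betw_same_card[of "\<lambda>x. x + z * a"])
    have shift: "Q (x + z * a) = z\<^sup>2 * Q b \<longleftrightarrow> Q x + z * T b x = 0" for x
      using Q_add[OF that, of x b] by (simp add: a_def)
    show "bij_betw (\<lambda>x. x + z * a) {x. Q x + z * T b x = 0} {x. Q x = z\<^sup>2 * Q b}"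
    proof (rule bij_betw_byWitness[where f' = "\<lambda>x. x - z * a"])
      show "(\<lambda>x. x + z * a) ` {x. Q x + z * T b x = 0} \<subseteq> {x. Q x = z\<^sup>2 * Q b}"
        by (auto simp only: shift)
      show "(\<lambda>x. x - z * a) ` {x. Q x = z\<^sup>2 * Q b} \<subseteq> {x. Q x + z * T b x = 0}"
        by (auto simp only: shift[symmetric] diff_add_cancel)
    qed auto
  qed
  have "(\<Sum>x\<in>UNIV. card {z\<in>F. Q x + z * T b x = 0}) = (\<Sum>z\<in>F. card {x. Q x + z * T b x = 0})"
    using sum_multicount_gen[of UNIV F "\<lambda>x z. Q x + z * T b x = 0" "\<lambda>z. card {x. Q x + z * T b x = 0}"]
    by simp
  also have "\<dots> = (\<Sum>z\<in>F. card {x. Q x = z\<^sup>2 * Q b})"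
    by (simp add: fibre)
  finally have "int (card {x. T b x \<noteq> 0} + q * N) = (\<Sum>z\<in>F. int (card {x. Q x = z\<^sup>2 * Q b}))"
    by (simp add: by_x)
  also have "\<dots> = (\<Sum>z\<in>F. if z\<^sup>2 * Q b = 0 then int q * X\<^sup>2 - int q * X + X else int q * X\<^sup>2 + X)"
    by (intro sum.cong refl int_card_Q_fibre) (simp add: mult_F Q_in_F power2_eq_square)
  \<comment> \<open>If \<open>b\<close> lies in \<open>D\<close>, every \<open>z\<close> contributes
    the fibre over 0; otherwise only \<open>z = 0\<close> does.\<close>
  also have "\<dots> = (if b \<in> D then int q * (int q * X\<^sup>2 - int q * X + X) else (int q)\<^sup>2 * X\<^sup>2)"
  proof (cases "b \<in> D")
    case True
    then show ?thesis by (simp add: D_def card_F)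
  next
    case False
    have "(\<Sum>z\<in>F. if z\<^sup>2 * Q b = 0 then int q * X\<^sup>2 - int q * X + X else int q * X\<^sup>2 + X)
      = int q * X\<^sup>2 - int q * X + X + (\<Sum>z\<in>F - {0}. int q * X\<^sup>2 + X)"
      using False zero_F finite_F by (subst sum.remove[of _ 0]) (auto simp: D_def)
    also have "\<dots> = (int q)\<^sup>2 * X\<^sup>2"
      using q_ge_2 zero_F finite_F 
      by (simp add: card_F of_nat_diff algebra_simps power2_eq_square)
    finally show ?thesis using False by simp
  qed
  finally have main: "int (card {x. T b x \<noteq> 0}) + int q * int N
      = (if b \<in> D then int q * (int q * X\<^sup>2 - int q * X + X) else (int q)\<^sup>2 * X\<^sup>2)" by simp
  have "{x. T b x \<noteq> 0} = UNIV - {x. T b x = 0}" by auto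
  then have "card {x. T b x \<noteq> 0} = q ^ (2 * r) - q ^ (2 * r - 1)"
    using card_T_fibre[OF b zero_F] card_UNIV by (simp only:) (subst card_Diff_subset; simp)
  moreover have "q ^ (2 * r - 1) \<le> q ^ (2 * r)"
    using q_ge_2 by (intro power_increasing) auto
  ultimately have "int (card {x. T b x \<noteq> 0}) = (int q)\<^sup>2 * X\<^sup>2 - int q * X\<^sup>2"
    by (simp add: of_nat_diff q_power_2r q_power_2r1[simplified])
  with main have "int q * int N
      = (if b \<in> D then int q * (int q * X\<^sup>2 - int q * X + X) else (int q)\<^sup>2 * X\<^sup>2)
        - ((int q)\<^sup>2 * X\<^sup>2 - int q * X\<^sup>2)" by linarith
  also have "\<dots> = int q * (if b \<in> D then X\<^sup>2 - int q * X + X else X\<^sup>2)"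
    by (cases "b \<in> D") (simp_all add: algebra_simps power2_eq_square)
  finally show ?thesis using q_ge_2 unfolding N_def by simp
qed

lemma scale_mem_D: "a \<in> F \<Longrightarrow> x \<in> D \<Longrightarrow> a * x \<in> D"
  by (simp add: D_def Q_scale)

text \<open>\<open>D\<close> is closed under scaling by \<open>F\<close>, so the
  \<open>q - 1\<close> nonzero levels of \<open>T b\<close> share equally what level 0 leaves
  over.\<close>

lemma card_D_hyperplane:
  assumes b: "b \<noteq> 0" and t: "t \<in> F" "t \<noteq> 0"
  shows "int (card {x\<in>D. T b x = t}) = (if b \<in> D then X\<^sup>2 else X\<^sup>2 - X)"
proof -
  have scaled: "card {x\<in>D. T b x = s} = card {x\<in>D. T b x = t}" if s: "s \<in> F - {0}" for s
  proof (rule bij_betw_same_card[of "\<lambda>x. (t / s) * x"])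
    have F: "t / s \<in> F" "s / t \<in> F" using s t by (auto simp: divide_F)
    show "bij_betw (\<lambda>x. (t / s) * x) {x\<in>D. T b x = s} {x\<in>D. T b x = t}"
    proof (rule bij_betw_byWitness[where f' = "\<lambda>x. (s / t) * x"])
      show "(\<lambda>x. (t / s) * x) ` {x\<in>D. T b x = s} \<subseteq> {x\<in>D. T b x = t}"
        using scale_mem_D[OF F(1)] T_scale[OF F(1)] s by auto
      show "(\<lambda>x. (s / t) * x) ` {x\<in>D. T b x = t} \<subseteq> {x\<in>D. T b x = s}"
        using scale_mem_D[OF F(2)] T_scale[OF F(2)] t by auto
    qed (use s t in auto)
  qed
  have "card D = (\<Sum>s\<in>F. card {x\<in>D. T b x = s})"
    by (rule card_eq_sum_fibres) (use T_in_F in auto)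
  also have "\<dots> = card {x\<in>D. T b x = 0} + (\<Sum>s\<in>F - {0}. card {x\<in>D. T b x = s})"
    using zero_F finite_F by (subst sum.remove[of _ 0]) auto
  also have "(\<Sum>s\<in>F - {0}. card {x\<in>D. T b x = s}) = (q - 1) * card {x\<in>D. T b x = t}"
    using scaled zero_F finite_F by (simp add: card_F)
  finally have "int (card D) = int (card {x\<in>D. T b x = 0})
      + (int q - 1) * int (card {x\<in>D. T b x = t})"
    using q_ge_2 by (simp add: of_nat_diff)
  then have "(int q - 1) * int (card {x\<in>D. T b x = t})
      = int q * X\<^sup>2 - int q * X + X - (if b \<in> D then X\<^sup>2 - int q * X + X else X\<^sup>2)"
    unfolding card_D_hyperplane_0[OF b] int_card_D by linarith
  also have "\<dots> = (int q - 1) * (if b \<in> D then X\<^sup>2 else X\<^sup>2 - X)"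
    by (cases "b \<in> D") (simp_all add: algebra_simps)
  finally show ?thesis using q_ge_2 by simp
qed

section \<open>The code and its weights\<close>

definition cw :: "'a \<Rightarrow> 'a \<Rightarrow> 'a \<Rightarrow> 'a" where
  "cw b c = (\<lambda>x. if x \<in> D then T b x + c else 0)"

definition C :: "('a \<Rightarrow> 'a) set" where "C = {cw b c | b c. c \<in> F}"

text \<open>The minimum distance of \<open>C\<close>.\<close>

abbreviation W1 :: int where "W1 \<equiv> int q * X\<^sup>2 - int q * X + X - X\<^sup>2"

lemma W1_pos: "W1 > 0"
proof -
  have "W1 = (int q - 1) * X * (X - 1)" by (simp add: algebra_simps power2_eq_square)
  moreover have "int q - 1 > 0" "X > 0" "X - 1 > 0" using X_ge q_ge_2 by linarith+
  ultimately show ?thesis by (metis mult_pos_pos)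
qed

lemma W1_le: "W1 \<le> X\<^sup>2 * (int q - 1)"
proof -
  have "X\<^sup>2 * (int q - 1) - W1 = (int q - 1) * X" by (simp add: algebra_simps power2_eq_square)
  moreover have "(int q - 1) * X \<ge> 0" using q_ge_2 by simp
  ultimately show ?thesis by linarith
qed

text \<open>The zeros of the word are the points of \<open>D\<close> on the affine hyperplane
  \<open>T b x = - c\<close>, whose number is known in every case.\<close>

lemma hweight_cw:
  assumes "c \<in> F"
  shows "int (hweight D (cw b c)) =
    (if b = 0 then if c = 0 then 0 else int (card D)
     else if b \<in> D then if c = 0 then X\<^sup>2 * (int q - 1) else W1
     else if c = 0 then W1 else W1 + X)"
proof -
  have "{x\<in>D. cw b c x \<noteq> 0} = D - {x\<in>D. T b x = - c}"
    by (auto simp: cw_def eq_neg_iff_add_eq_0)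
  then have "hweight D (cw b c) = card D - card {x\<in>D. T b x = - c}"
    by (simp add: hweight_def card_Diff_subset)
  moreover have "card {x\<in>D. T b x = - c} \<le> card D"
    by (intro card_mono) auto
  ultimately have wt: "int (hweight D (cw b c)) = int (card D) - int (card {x\<in>D. T b x = - c})"
    by (simp add: of_nat_diff)
  consider "b = 0" | "b \<noteq> 0" "c = 0" | "b \<noteq> 0" "c \<noteq> 0" by blast
  then show ?thesis
  proof cases
    case 1
    then show ?thesis unfolding wt by simp
  next
    case 2
    then show ?thesis unfolding wt int_card_D
      using card_D_hyperplane_0[of b] by (simp add: algebra_simps)
  next
    case 3
    then have "int (card {x\<in>D. T b x = - c}) = (if b \<in> D then X\<^sup>2 else X\<^sup>2 - X)"
      using card_D_hyperplane[of b "- c"] assms by (simp add: uminus_F)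
    with 3 show ?thesis unfolding wt int_card_D by simp
  qed
qed

lemma W1_le_card_D: "W1 \<le> int (card D)"
  by (simp add: int_card_D)

lemma W1_le_hweight_cw:
  assumes "c \<in> F" "(b, c) \<noteq> (0, 0)"
  shows "W1 \<le> int (hweight D (cw b c))"
proof -
  have "W1 \<le> W1 + X" by simp
  then show ?thesis
    unfolding hweight_cw[OF assms(1)] using assms(2) W1_le W1_le_card_D
    by (auto simp only: prod.inject order.refl split: if_split)
qed

lemma cw_add: "(\<lambda>x. cw b c x + cw b' c' x) = cw (b + b') (c + c')"
  by (auto simp: cw_def T_add_left)

lemma cw_scale: "a \<in> F \<Longrightarrow> (\<lambda>x. a * cw b c x) = cw (a * b) (a * c)"
  by (auto simp: cw_def T_scale_left distrib_left)

lemma cw_0: "cw 0 0 = (\<lambda>_. 0)"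
  by (auto simp: cw_def)

text \<open>The zero word has weight 0, below the positive bound \<open>W1\<close> for all other
  parameters. This yields injectivity of the encoding.\<close>

lemma cw_eq_0_iff: "c \<in> F \<Longrightarrow> cw b c = (\<lambda>_. 0) \<longleftrightarrow> b = 0 \<and> c = 0"
proof
  assume "c \<in> F" "cw b c = (\<lambda>_. 0)"
  moreover from this have "hweight D (cw b c) = 0" by (simp add: hweight_def)
  ultimately show "b = 0 \<and> c = 0" using W1_le_hweight_cw[of c b] W1_pos by auto
qed (auto simp: cw_0)

lemma bij_betw_cw: "bij_betw (\<lambda>(b, c). cw b c) (UNIV \<times> F) C"
proof -
  have inj: "(b, c) = (b', c')" if "c \<in> F" "c' \<in> F" "cw b c = cw b' c'" for b c b' c'
  proof -
    have "(\<lambda>x. cw b c x + cw (- b') (- c') x) = (\<lambda>x. cw b' c' x + cw (- b') (- c') x)"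
      by (simp only: that)
    then have "cw (b - b') (c - c') = (\<lambda>_. 0)"
      by (simp add: cw_add cw_0)
    then show ?thesis using that by (simp add: cw_eq_0_iff diff_F)
  qed
  have "inj_on (\<lambda>(b, c). cw b c) (UNIV \<times> F)"
    using inj by (auto intro!: inj_onI)
  moreover have "(\<lambda>(b, c). cw b c) ` (UNIV \<times> F) = C"
    by (auto simp: C_def)
  ultimately show ?thesis by (simp add: bij_betw_def)
qed

lemma card_C: "card C = q ^ (2 * r + 1)"
  using bij_betw_same_card[OF bij_betw_cw] by (simp add: card_cartesian_product card_F card_UNIV mult.commute)

lemma finite_C: "finite C"
  using bij_betw_finite[OF bij_betw_cw] by simp

lemma is_linear_code_C: "is_linear_code F D C"
  unfolding is_linear_code_def
proof (intro conjI ballI)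
  show "C \<subseteq> vecs F D" by (auto simp: C_def cw_def vecs_def T_in_F add_F)
  show "(\<lambda>_. 0) \<in> C" using zero_F cw_0 unfolding C_def by (metis (mono_tags, lifting) mem_Collect_eq)
  show "(\<lambda>x. u x + v x) \<in> C" if uv: "u \<in> C" "v \<in> C" for u v
  proof -
    obtain b c b' c' where "u = cw b c" "v = cw b' c'" "c \<in> F" "c' \<in> F"
      using uv unfolding C_def by blast
    then show ?thesis unfolding C_def using add_F cw_add by blast
  qed
  show "(\<lambda>x. a * u x) \<in> C" if "a \<in> F" and u: "u \<in> C" for a u
  proof -
    obtain b c where "u = cw b c" "c \<in> F" using u unfolding C_def by blast
    then show ?thesis unfolding C_def using mult_F cw_scale \<open>a \<in> F\<close> by blast
  qed
qed

lemma card_F_nonzero: "of_nat (card (F - {0})) = int q - 1"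
  using q_ge_2 zero_F finite_F by (simp add: card_F of_nat_diff)

text \<open>The count runs over the pairs \<open>(b, c)\<close>, split by \<open>b = 0\<close>,
  \<open>b\<close> in \<open>D - {0}\<close> or \<open>b\<close> outside \<open>D\<close>, and by
  \<open>c = 0\<close> or not. The sum of indicators stays correct when weights coincide, as
  \<open>W1 + X\<close> and \<open>X ^ 2 * (q - 1)\<close> do for \<open>q = 2\<close>.\<close>

lemma card_weight_class:
  "int (card {v\<in>C. hweight D v = w}) =
     of_bool (w = 0) + (int q - 1) * of_bool (int w = int (card D))
   + (int (card D) - 1) * (of_bool (int w = X\<^sup>2 * (int q - 1)) + (int q - 1) * of_bool (int w = W1))
   + ((int q)\<^sup>2 * X\<^sup>2 - int (card D)) * (of_bool (int w = W1) + (int q - 1) * of_bool (int w = W1 + X))"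
proof -
  define f where "f b = (\<Sum>c\<in>F. of_bool (hweight D (cw b c) = w) :: int)" for b
  have bij: "bij_betw (\<lambda>(b, c). cw b c) {z \<in> UNIV \<times> F. hweight D (case_prod cw z) = w} {v\<in>C. hweight D v = w}"
    by (rule bij_betw_Collect[OF bij_betw_cw]) auto
  have "int (card {v\<in>C. hweight D v = w}) = int (card {z \<in> UNIV \<times> F. hweight D (case_prod cw z) = w})"
    using bij_betw_same_card[OF bij] by simp
  also have "\<dots> = (\<Sum>z\<in>UNIV \<times> F. of_bool (hweight D (case_prod cw z) = w))"
    by (simp add: Int_def)
  also have "\<dots> = (\<Sum>b\<in>UNIV. f b)"
    unfolding f_def sum.cartesian_product by (intro sum.cong) auto
  also have "\<dots> = f 0 + (\<Sum>b\<in>D - {0}. f b) + (\<Sum>b\<in>-D. f b)"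
  proof -
    have "0 \<in> D" by (simp add: D_def)
    have "(\<Sum>b\<in>UNIV. f b) = (\<Sum>b\<in>D. f b) + (\<Sum>b\<in>-D. f b)"
      by (subst sum.union_disjoint[symmetric]) auto
    also have "(\<Sum>b\<in>D. f b) = f 0 + (\<Sum>b\<in>D - {0}. f b)"
      using \<open>0 \<in> D\<close> by (subst sum.remove[of _ 0]) auto
    finally show ?thesis .
  qed
  also have "f 0 = of_bool (w = 0) + (int q - 1) * of_bool (int w = int (card D))"
  proof -
    have "f 0 = of_bool (hweight D (cw 0 0) = w) + (\<Sum>c\<in>F - {0}. of_bool (hweight D (cw 0 c) = w))"
      unfolding f_def using zero_F finite_F by (subst sum.remove[of _ 0]) auto
    moreover have "(\<Sum>c\<in>F - {0}. of_bool (hweight D (cw 0 c) = w) :: int) = (\<Sum>c\<in>F - {0}. of_bool (int w = int (card D)))"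
    proof (intro sum.cong refl)
      fix c assume "c \<in> F - {0}"
      then have "hweight D (cw 0 c) = card D" using hweight_cw[of c 0] by simp
      then show "of_bool (hweight D (cw 0 c) = w) = (of_bool (int w = int (card D)) :: int)"
        by (simp only: of_nat_eq_iff eq_commute)
    qed
    moreover have "hweight D (cw 0 0) = 0" using hweight_cw[OF zero_F, of 0] by simp
    moreover have "(of_bool (0 = w) :: int) = of_bool (w = 0)" by auto
    ultimately show ?thesis by (simp only: sum_constant card_F_nonzero)
  qed
  also have "(\<Sum>b\<in>D - {0}. f b)
      = (\<Sum>b\<in>D - {0}. of_bool (int w = X\<^sup>2 * (int q - 1)) + (int q - 1) * of_bool (int w = W1))"
  proof (intro sum.cong refl)
    fix b assume b: "b \<in> D - {0}"
    have "f b = of_bool (hweight D (cw b 0) = w) + (\<Sum>c\<in>F - {0}. of_bool (hweight D (cw b c) = w))"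
      unfolding f_def using zero_F finite_F by (subst sum.remove[of _ 0]) auto
    also have "(\<Sum>c\<in>F - {0}. of_bool (hweight D (cw b c) = w) :: int) = (\<Sum>c\<in>F - {0}. of_bool (int w = W1))"
      using hweight_cw[of _ b] b by (intro sum.cong refl) (auto simp flip: of_nat_eq_iff[where 'a = int])
    also have "of_bool (hweight D (cw b 0) = w) = (of_bool (int w = X\<^sup>2 * (int q - 1)) :: int)"
      using hweight_cw[OF zero_F, of b] b by (auto simp flip: of_nat_eq_iff[where 'a = int])
    finally show "f b = of_bool (int w = X\<^sup>2 * (int q - 1)) + (int q - 1) * of_bool (int w = W1)"
      by (simp only: sum_constant card_F_nonzero)
  qed
  also have "(\<Sum>b\<in>-D. f b)
      = (\<Sum>b\<in>-D. of_bool (int w = W1) + (int q - 1) * of_bool (int w = W1 + X))"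
  proof (intro sum.cong refl)
    fix b assume "b \<in> -D"
    then have b: "b \<notin> D" "b \<noteq> 0" by (auto simp: D_def)
    have "f b = of_bool (hweight D (cw b 0) = w) + (\<Sum>c\<in>F - {0}. of_bool (hweight D (cw b c) = w))"
      unfolding f_def using zero_F finite_F by (subst sum.remove[of _ 0]) auto
    also have "(\<Sum>c\<in>F - {0}. of_bool (hweight D (cw b c) = w) :: int) = (\<Sum>c\<in>F - {0}. of_bool (int w = W1 + X))"
      using hweight_cw[of _ b] b by (intro sum.cong refl) (auto simp flip: of_nat_eq_iff[where 'a = int])
    also have "of_bool (hweight D (cw b 0) = w) = (of_bool (int w = W1) :: int)"
      using hweight_cw[OF zero_F, of b] b by (auto simp flip: of_nat_eq_iff[where 'a = int])
    finally show "f b = of_bool (int w = W1) + (int q - 1) * of_bool (int w = W1 + X)"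
      by (simp only: sum_constant card_F_nonzero)
  qed
  also have "(\<Sum>b\<in>D - {0}. of_bool (int w = X\<^sup>2 * (int q - 1)) + (int q - 1) * of_bool (int w = W1))
      = (int (card D) - 1) * (of_bool (int w = X\<^sup>2 * (int q - 1)) + (int q - 1) * of_bool (int w = W1))"
  proof -
    have "0 \<in> D" by (simp add: D_def)
    then have "card D \<ge> 1" by (metis One_nat_def Suc_leI card_gt_0_iff empty_iff finite)
    with \<open>0 \<in> D\<close> show ?thesis by (simp add: of_nat_diff)
  qed
  also have "(\<Sum>b\<in>-D. of_bool (int w = W1) + (int q - 1) * of_bool (int w = W1 + X))
      = ((int q)\<^sup>2 * X\<^sup>2 - int (card D)) * (of_bool (int w = W1) + (int q - 1) * of_bool (int w = W1 + X))"
  proof -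
    have "int (card (-D)) = int (card (UNIV :: 'a set)) - int (card D)"
      by (simp add: Compl_eq_Diff_UNIV card_Diff_subset of_nat_diff card_mono)
    then have "int (card (-D)) = (int q)\<^sup>2 * X\<^sup>2 - int (card D)"
      by (simp add: card_UNIV q_power_2r)
    then show ?thesis by simp
  qed
  finally show ?thesis .
qed

section \<open>Minimum distance of the code\<close>

lemma X_ge_2: "X \<ge> 2"
  using X_ge q_ge_2 by linarith

lemma exists_nonzero_D: "\<exists>x\<in>D. x \<noteq> 0"
proof (rule ccontr)
  assume "\<not> ?thesis"
  then have "D \<subseteq> {0}" by auto
  then have "int (card D) \<le> 1" using card_mono[of "{0}" D] by simp
  moreover have "int (card D) = W1 + X\<^sup>2" by (simp add: int_card_D)
  moreover have "X\<^sup>2 \<ge> 2 * 2" unfolding power2_eq_square using X_ge_2 by (intro mult_mono) auto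
  ultimately show False using W1_pos by linarith
qed

text \<open>\<open>D\<close> is too small to be the whole field. Any \<open>b\<close> outside it
  gives a word \<open>cw b 0\<close> that attains the weight \<open>W1\<close>.\<close>

lemma exists_not_D: "\<exists>x. x \<notin> D"
proof (rule ccontr)
  assume "\<not> ?thesis"
  then have "D = UNIV" by auto
  then have "int q * X\<^sup>2 - int q * X + X = (int q)\<^sup>2 * X\<^sup>2"
    using int_card_D card_UNIV by (simp add: q_power_2r)
  moreover have "int q * X\<^sup>2 \<le> (int q)\<^sup>2 * X\<^sup>2"
    using q_ge_2 by (intro mult_right_mono) (auto simp: power2_eq_square)
  moreover have "int q * X \<ge> 2 * X" using q_ge_2 by (intro mult_right_mono) auto
  ultimately show False using X_ge_2 by linarith
qed

lemma min_dist_C: "int (min_dist D C) = W1"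
proof -
  obtain b where b: "b \<notin> D" using exists_not_D by blast
  then have "b \<noteq> 0" by (auto simp: D_def)
  have "min_dist D C = hweight D (cw b 0)"
  proof (rule min_dist_eqI)
    show "cw b 0 \<in> C" using zero_F by (auto simp: C_def)
    show "cw b 0 \<noteq> (\<lambda>_. 0)" using \<open>b \<noteq> 0\<close> by (simp add: cw_eq_0_iff zero_F)
    fix v assume "v \<in> C" "v \<noteq> (\<lambda>_. 0)"
    then obtain b' c where "v = cw b' c" "c \<in> F" by (auto simp: C_def)
    moreover from this have "(b', c) \<noteq> (0, 0)" using \<open>v \<noteq> (\<lambda>_. 0)\<close> cw_0 by auto
    ultimately have "W1 \<le> int (hweight D v)" using W1_le_hweight_cw by simp
    then show "hweight D (cw b 0) \<le> hweight D v"
      using hweight_cw[OF zero_F, of b] b \<open>b \<noteq> 0\<close> by simp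
  qed (simp add: finite_C)
  then show ?thesis using hweight_cw[OF zero_F, of b] b \<open>b \<noteq> 0\<close> by simp
qed

section \<open>The dual code and its minimum distance\<close>

lemma T_commute: "T b x = T x b"
  by (simp add: T_def mult.commute)

lemma T_nondegenerate:
  assumes "\<And>b. T b s = 0"
  shows "s = 0"
proof (rule ccontr)
  assume "s \<noteq> 0"
  moreover have "{x. T s x = 0} = UNIV" using assms by (auto simp: T_commute)
  ultimately have "q ^ (2 * r) = q ^ (2 * r - 1)"
    using card_T_fibre[of s 0] card_UNIV zero_F by simp
  then show False using q_ge_2 r_ge_2 by (simp add: power_inject_exp)
qed

text \<open>Pairing with \<open>cw b c\<close> gives \<open>T b\<close> of the weighted point sum
  plus \<open>c\<close> times the coefficient sum. Taking \<open>b = 0\<close>, \<open>c = 1\<close>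
  isolates the second term; \<open>c = 0\<close> and nondegeneracy of \<open>T\<close> handle the
  first.\<close>

lemma mem_dual_iff:
  "v \<in> dual_code F D C \<longleftrightarrow> v \<in> vecs F D \<and> (\<Sum>x\<in>D. v x) = 0 \<and> (\<Sum>x\<in>D. v x * x) = 0"
proof -
  have pairing: "(\<Sum>x\<in>D. cw b c x * v x) = T b (\<Sum>x\<in>D. v x * x) + c * (\<Sum>x\<in>D. v x)"
    if v: "v \<in> vecs F D" for b c
  proof -
    have "(\<Sum>x\<in>D. cw b c x * v x) = (\<Sum>x\<in>D. T b (v x * x) + c * v x)"
      using v by (intro sum.cong refl) (auto simp: cw_def vecs_def T_scale distrib_right mult.commute[of "T b _"])
    then show ?thesis by (simp add: sum.distrib T_sum sum_distrib_left)
  qed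
  show ?thesis
  proof
    assume "v \<in> dual_code F D C"
    then have v: "v \<in> vecs F D" and eq: "(\<Sum>x\<in>D. cw b c x * v x) = 0" if "c \<in> F" for b c
      using that by (auto simp: dual_code_def C_def)
    have vF: "v \<in> vecs F D" using v zero_F by blast
    have "(\<Sum>x\<in>D. v x) = 0" using eq[of 1 0] pairing[OF vF, of 0 1] one_F by simp
    moreover have "T b (\<Sum>x\<in>D. v x * x) = 0" for b
      using eq[of 0 b] pairing[OF vF, of b 0] zero_F by simp
    ultimately show "v \<in> vecs F D \<and> (\<Sum>x\<in>D. v x) = 0 \<and> (\<Sum>x\<in>D. v x * x) = 0"
      using vF T_nondegenerate by blast
  next
    assume "v \<in> vecs F D \<and> (\<Sum>x\<in>D. v x) = 0 \<and> (\<Sum>x\<in>D. v x * x) = 0"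
    then show "v \<in> dual_code F D C"
      using pairing by (auto simp: dual_code_def C_def)
  qed
qed

lemma finite_dual: "finite (dual_code F D C)"
  using card_vecs(1)[of D] by (simp add: dual_code_def)

lemma dual_support_sums:
  assumes "v \<in> dual_code F D C"
  shows "(\<Sum>x\<in>{x\<in>D. v x \<noteq> 0}. v x) = 0" "(\<Sum>x\<in>{x\<in>D. v x \<noteq> 0}. v x * x) = 0"
proof -
  have "(\<Sum>x\<in>{x\<in>D. v x \<noteq> 0}. v x) = (\<Sum>x\<in>D. v x)" "(\<Sum>x\<in>{x\<in>D. v x \<noteq> 0}. v x * x) = (\<Sum>x\<in>D. v x * x)"
    by (intro sum.mono_neutral_left; auto)+
  then show "(\<Sum>x\<in>{x\<in>D. v x \<noteq> 0}. v x) = 0" "(\<Sum>x\<in>{x\<in>D. v x \<noteq> 0}. v x * x) = 0"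
    using assms by (auto simp: mem_dual_iff)
qed

text \<open>A single point has no affine dependency, and the coefficients at two points would be
  opposite, which forces the points to be equal.\<close>

lemma hweight_dual_ge_3:
  assumes v: "v \<in> dual_code F D C" "v \<noteq> (\<lambda>_. 0)"
  shows "hweight D v \<ge> 3"
proof -
  define S where "S = {x\<in>D. v x \<noteq> 0}"
  have sums: "(\<Sum>x\<in>S. v x) = 0" "(\<Sum>x\<in>S. v x * x) = 0"
    using dual_support_sums[OF v(1)] by (simp_all add: S_def)
  have nz: "v x \<noteq> 0" if "x \<in> S" for x using that by (simp add: S_def)
  have "S \<noteq> {}" using v by (auto simp: S_def mem_dual_iff vecs_def fun_eq_iff)
  then have "card S \<noteq> 0" by simp
  moreover have "card S \<noteq> 1"
  proof
    assume "card S = 1"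
    then obtain x where "S = {x}" by (auto simp: card_1_singleton_iff)
    then show False using sums nz by auto
  qed
  moreover have "card S \<noteq> 2"
  proof
    assume "card S = 2"
    then obtain x y where S: "S = {x, y}" "x \<noteq> y" by (auto simp: card_2_iff)
    then have "v x + v y = 0" "v x * x + v y * y = 0" using sums by auto
    moreover from this have "v y = - v x" by (simp add: eq_neg_iff_add_eq_0 add.commute)
    ultimately have "v x * (x - y) = 0" by (simp add: right_diff_distrib)
    then show False using S nz by auto
  qed
  ultimately have "card S \<ge> 3" by linarith
  then show ?thesis by (simp only: hweight_def S_def)
qed

lemma min_dist_dual_3:
  assumes "q > 2"
  shows "min_dist D (dual_code F D C) = 3"
proof -
  obtain x where x: "x \<in> D" "x \<noteq> 0" using exists_nonzero_D by blast
  have "F - {0, 1} \<noteq> {}"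
  proof
    assume "F - {0, 1} = {}"
    then have "card F \<le> card {0, 1 :: 'a}" by (intro card_mono) auto
    then show False using card_F assms by simp
  qed
  then obtain l where l: "l \<in> F" "l \<noteq> 0" "l \<noteq> 1" by auto
  \<comment> \<open>The affine relation \<open>(l - 1) * 0 - l * x + 1 * (l * x) = 0\<close>, whose
    coefficients sum to 0; \<open>q > 2\<close> provides an \<open>l\<close> for which the three
    points are distinct.\<close>
  define v where "v = (\<lambda>y. if y = 0 then l - 1 else if y = x then - l else if y = l * x then 1 else 0)"
  have D: "0 \<in> D" "l * x \<in> D" using x l scale_mem_D by (auto simp: D_def)
  have ne: "l * x \<noteq> 0" "l * x \<noteq> x" using x l by auto
  have supp: "{y\<in>D. v y \<noteq> 0} = {0, x, l * x}"
    using D x l ne by (auto simp: v_def)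
  have sums: "(\<Sum>y\<in>D. f (v y) y) = (\<Sum>y\<in>{0, x, l * x}. f (v y) y)"
    if "\<And>y. f 0 y = 0" for f :: "'a \<Rightarrow> 'a \<Rightarrow> 'a"
    using D x ne that by (intro sum.mono_neutral_right) (auto simp: v_def)
  have "v \<in> vecs F D"
    using D x l by (auto simp: v_def vecs_def zero_F one_F uminus_F diff_F)
  moreover have "(\<Sum>y\<in>D. v y) = 0" "(\<Sum>y\<in>D. v y * y) = 0"
    using sums[of "\<lambda>c y. c"] sums[of "\<lambda>c y. c * y"] ne ne[symmetric] x x(2)[symmetric]
    by (simp_all add: v_def)
  ultimately have v: "v \<in> dual_code F D C" by (simp add: mem_dual_iff)
  have wt: "hweight D v = 3"
    unfolding hweight_def supp using ne x by (simp add: card_insert_if)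
  have "v \<noteq> (\<lambda>_. 0)" using wt by (auto simp: hweight_def)
  then have "min_dist D (dual_code F D C) = hweight D v"
    using v wt hweight_dual_ge_3 by (intro min_dist_eqI finite_dual) auto
  then show ?thesis using wt by simp
qed

lemma min_dist_dual_4:
  assumes q: "q = 2" and r: "r > 2"
  shows "min_dist D (dual_code F D C) = 4"
proof -
  have F: "{0, 1} = F"
  proof (rule card_subset_eq)
    show "card {0, 1 :: 'a} = card F" unfolding card_F unfolding q by simp
  qed (simp_all add: zero_F one_F finite_F)
  have two: "(1 + 1 :: 'a) = 0"
    using add_F[OF one_F one_F] unfolding F[symmetric]
    by (metis add_cancel_right_right insertE one_neq_zero singletonD)
  have double: "x + x = 0" for x :: 'a
    using distrib_left[of x 1 1] two by (simp only: mult_1_right mult_zero_right)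
  have lower: "hweight D v \<ge> 4" if v: "v \<in> dual_code F D C" "v \<noteq> (\<lambda>_. 0)" for v
  proof -
    have "hweight D v \<noteq> 3"
    proof
      assume "hweight D v = 3"
      then have card: "card {x\<in>D. v x \<noteq> 0} = 3" by (simp add: hweight_def)
      \<comment> \<open>Over the field of two elements every nonzero coefficient is 1, and three of
        them cannot sum to 0.\<close>
      have "v x = 1" if "x \<in> D" "v x \<noteq> 0" for x
        using v that F by (auto simp: mem_dual_iff vecs_def)
      then have "(\<Sum>x\<in>{x\<in>D. v x \<noteq> 0}. v x) = (\<Sum>x\<in>{x\<in>D. v x \<noteq> 0}. 1)"
        by (intro sum.cong) auto
      also have "\<dots> = 1 + 1 + 1" by (simp add: card)
      finally have "0 = 1 + 1 + (1 :: 'a)" by (simp only: dual_support_sums(1)[OF v(1)])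
      then show False by (simp only: two add_0 zero_neq_one)
    qed
    with hweight_dual_ge_3[OF v] show ?thesis by simp
  qed
  obtain x where x: "x \<in> D" "x \<noteq> 0" using exists_nonzero_D by blast
  \<comment> \<open>The conjugate of \<open>x\<close>, so that \<open>Q_add\<close> at
    \<open>z = 1\<close> expands \<open>Q (y + x)\<close> with cross term
    \<open>T b y\<close>.\<close>
  define b where "b = x ^ (q ^ r)"
  have b: "b \<noteq> 0" "b \<in> D" "b ^ (q ^ r) = x"
    using x by (auto simp: b_def D_def Q_power_q_r power_q_r_twice)
  have "int (card {y\<in>D. T b y = 0}) = X * (X - 1)"
    using card_D_hyperplane_0[OF b(1)] b(2) q by (simp add: power2_eq_square algebra_simps)
  \<comment> \<open>Here \<open>r > 2\<close> enters: the section then has at least 12 points, hence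
    one outside \<open>{0, x}\<close>.\<close>
  moreover have "X \<ge> 4"
    using q r power_increasing[of 2 "r - 1" "2::int"] by simp
  then have "X * (X - 1) \<ge> 4 * 3" by (intro mult_mono) auto
  ultimately have "card {y\<in>D. T b y = 0} > 2" by linarith
  then have "\<not> {y\<in>D. T b y = 0} \<subseteq> {0, x}"
    using card_mono[of "{0, x}" "{y\<in>D. T b y = 0}"] card_insert_le_m1[of 2 "{x}" 0] by auto
  then obtain y where y: "y \<in> D" "T b y = 0" "y \<noteq> 0" "y \<noteq> x" by auto
  have xyD: "y + x \<in> D"
    using Q_add[OF one_F, of y b] y b by (simp add: D_def)
  have "0 \<in> D" by (simp add: D_def)
  have "y + x \<noteq> 0" using double[of x] y by (metis add_right_cancel)
  \<comment> \<open>A totally singular plane; with all coefficients 1, both sums over it vanish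
    since \<open>x\<close>, \<open>y\<close> and 1 occur an even number of times.\<close>
  define S where "S = {0, x, y, y + x}"
  have SD: "S \<subseteq> D" using \<open>0 \<in> D\<close> xyD x y by (auto simp: S_def)
  define v where "v = (\<lambda>z. if z \<in> S then 1 else 0 :: 'a)"
  have ne: "y + x \<noteq> 0" "0 \<noteq> y + x" "x \<noteq> y" "0 \<noteq> x" "0 \<noteq> y" "x \<noteq> 0" "y \<noteq> 0" "y \<noteq> x"
    using \<open>y + x \<noteq> 0\<close> x y by auto
  have supp: "{z\<in>D. v z \<noteq> 0} = S" using SD by (auto simp: v_def)
  have "v \<in> vecs F D" using SD by (auto simp: v_def vecs_def zero_F one_F)
  moreover have "(\<Sum>z\<in>D. v z) = (\<Sum>z\<in>S. 1)"
    by (rule sum.mono_neutral_cong_right) (use SD in \<open>auto simp: v_def\<close>)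
  moreover have "(\<Sum>z\<in>D. v z * z) = (\<Sum>z\<in>S. z)"
    by (rule sum.mono_neutral_cong_right) (use SD in \<open>auto simp: v_def\<close>)
  moreover have "(\<Sum>z\<in>S. 1) = (1 + 1) + (1 + 1 :: 'a)" "(\<Sum>z\<in>S. z) = (x + x) + (y + y)"
    unfolding S_def using ne by (simp_all add: algebra_simps)
  ultimately have v: "v \<in> dual_code F D C" by (simp only: mem_dual_iff double)
  have wt: "hweight D v = 4"
    unfolding hweight_def supp using ne by (simp add: S_def card_insert_if)
  have "v \<noteq> (\<lambda>_. 0)" using wt by (auto simp: hweight_def)
  then have "min_dist D (dual_code F D C) = hweight D v"
    using v wt lower by (intro min_dist_eqI finite_dual) auto
  then show ?thesis using wt by simp
qed

text \<open>Divisibility of \<open>q ^ card D\<close> by \<open>card C\<close> shows that the length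
  is at least the dimension, so the exponent is a genuine difference.\<close>

lemma card_dual_C:
  "2 * r + 1 \<le> card D" "card (dual_code F D C) = q ^ (card D - 2 * r - 1)"
proof -
  have eq: "q ^ (2 * r + 1) * card (dual_code F D C) = q ^ card D"
    using card_dual_code[OF _ is_linear_code_C] by (simp add: card_C card_F)
  then have "q ^ (2 * r + 1) dvd q ^ card D" by (metis dvd_triv_left)
  then show le: "2 * r + 1 \<le> card D" using q_ge_2 by (simp add: power_dvd_imp_le)
  have "q ^ card D = q ^ (2 * r + 1) * q ^ (card D - (2 * r + 1))"
    using le by (metis le_add_diff_inverse power_add)
  with eq have "q ^ (2 * r + 1) * card (dual_code F D C) = q ^ (2 * r + 1) * q ^ (card D - (2 * r + 1))"
    by simp
  moreover have "q ^ (2 * r + 1) \<noteq> 0" using q_ge_2 by simp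
  ultimately show "card (dual_code F D C) = q ^ (card D - 2 * r - 1)"
    by (metis mult_cancel_left diff_diff_left)
qed

section \<open>Closed forms in \<open>q\<close> and \<open>r\<close>, and the sphere-packing
  bound\<close>

lemma card_D: "card D = q ^ (r - 1) * (q ^ r - q + 1)"
proof -
  have "q \<le> q ^ r" using q_ge_2 r_ge_2 by (simp add: self_le_power)
  then have "int (q ^ (r - 1) * (q ^ r - q + 1)) = X * (int q ^ r - int q + 1)"
    by (simp add: of_nat_diff distrib_left)
  also have "\<dots> = int (card D)"
    unfolding int_card_D q_power_r by (simp add: algebra_simps power2_eq_square)
  finally show ?thesis by (simp only: of_nat_eq_iff)
qed

lemma min_dist_C_nat: "min_dist D C = q ^ (r - 1) * (q ^ r - q ^ (r - 1) - q + 1)"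
proof -
  \<comment> \<open>With \<open>q <= X\<close> this shows that the subtractions on natural numbers
    are exact.\<close>
  have "2 * X \<le> int q * X" using q_ge_2 by (intro mult_right_mono) auto
  with X_ge have "X + int q \<le> int q ^ r" unfolding q_power_r by linarith
  then have "int (q ^ (r - 1) + q) \<le> int (q ^ r)" by simp
  then have le: "q ^ (r - 1) + q \<le> q ^ r" by (simp only: of_nat_le_iff)
  then have "int (q ^ r - q ^ (r - 1) - q) = int q ^ r - X - int q"
    by (simp add: of_nat_diff)
  then have "int (q ^ (r - 1) * (q ^ r - q ^ (r - 1) - q + 1)) = X * (int q ^ r - X - int q + 1)"
    by (simp add: distrib_left)
  also have "\<dots> = int (min_dist D C)"
    unfolding min_dist_C q_power_r by (simp add: algebra_simps power2_eq_square)
  finally show ?thesis by (simp only: of_nat_eq_iff)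
qed

lemma code_params_C:
  "code_params F q D C (q ^ (r - 1) * (q ^ r - q + 1)) (2 * r + 1)
     (q ^ (r - 1) * (q ^ r - q ^ (r - 1) - q + 1))"
  unfolding code_params_def
  using is_linear_code_C card_D card_C min_dist_C_nat by simp

lemma weight_distribution_C:
  "int (card {v \<in> C. hweight D v = w}) =
          (if int w = 0 then 1 else 0)
        + (if int w = int q ^ (r - 1) * (int q ^ r - int q ^ (r - 1) - int q + 1)
           then int q ^ (r - 1) * (2 * int q ^ (r + 1) - 2 * int q ^ r - int q ^ 2 + 3 * int q - 2)
                - int q + 1 else 0)
        + (if int w = int q ^ (r - 1) * (int q ^ r - int q ^ (r - 1) - int q + 2)
           then int q ^ (r - 1) * (int q - 1) * (int q ^ (r + 1) - int q ^ r + int q - 1) else 0)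
        + (if int w = int q ^ (2 * r - 2) * (int q - 1)
           then int q ^ (r - 1) * (int q ^ r - int q + 1) - 1 else 0)
        + (if int w = int q ^ (r - 1) * (int q ^ r - int q + 1)
           then int q - 1 else 0)"
proof -
  \<comment> \<open>With \<open>Y\<close> and \<open>k\<close> as atoms the frequencies become
    polynomial identities in two variables. That of \<open>W1\<close> collects two classes:
    \<open>b\<close> in \<open>D - {0}\<close> with \<open>c\<close> nonzero, and \<open>b\<close>
    outside \<open>D\<close> with \<open>c = 0\<close>.\<close>
  define Y where "Y = X"
  define k where "k = int q"
  have W: "X * (int q ^ r - X - int q + 1) = W1" "X * (int q ^ r - X - int q + 2) = W1 + X"
    "X * (int q ^ r - int q + 1) = int (card D)"
    unfolding q_power_r int_card_D by (simp_all add: algebra_simps power2_eq_square)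
  have freq1: "X * (2 * int q ^ (r + 1) - 2 * int q ^ r - int q ^ 2 + 3 * int q - 2) - int q + 1
      = (int (card D) - 1) * (int q - 1) + ((int q)\<^sup>2 * X\<^sup>2 - int (card D))"
    unfolding power_add q_power_r int_card_D
    by (fold Y_def k_def) (simp add: algebra_simps power2_eq_square)
  have freq2: "X * (int q - 1) * (int q ^ (r + 1) - int q ^ r + int q - 1)
      = ((int q)\<^sup>2 * X\<^sup>2 - int (card D)) * (int q - 1)"
    unfolding power_add q_power_r int_card_D
    by (fold Y_def k_def) (simp add: algebra_simps power2_eq_square)
  have zero: "int w = 0 \<longleftrightarrow> w = 0" by simp
  have split: "(if P then x else 0) = x * of_bool P" for P and x :: int by simp
  show ?thesis
    unfolding W freq1 freq2 card_weight_class q_power_2r2 zero split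
    by (simp only: distrib_left distrib_right mult.assoc mult_1_left add.assoc add.commute
        add.left_commute)
qed

lemma code_params_dual:
  assumes "min_dist D (dual_code F D C) = d"
  shows "code_params F q D (dual_code F D C) (card D) (card D - 2 * r - 1) d"
  unfolding code_params_def using is_linear_code_dual card_dual_C(2) assms by simp

text \<open>Bounding \<open>card D - 1\<close> below by \<open>A\<close> and cancelling
  \<open>X ^ 2\<close> reduces the ball estimate to
  \<open>2 * q ^ 3 <= (q - 1) ^ 4 * X ^ 2\<close>.\<close>

lemma sphere_packing_dual:
  assumes "q > 2 \<or> r > 2"
  shows "sphere_packing_rules_out q (card D) (card D - 2 * r - 1) 5"
proof -
  define A where "A = (int q - 1) * X\<^sup>2"
  have "A \<ge> 0" using q_ge_2 by (simp add: A_def)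
  have "int (card D) = A + X + X * (X - int q)"
    unfolding int_card_D A_def by (simp add: algebra_simps power2_eq_square)
  moreover have "X * (X - int q) \<ge> 0" using X_ge by (intro mult_nonneg_nonneg) auto
  ultimately have "A \<le> int (card D) - 1" using X_ge_2 by linarith
  then have "A * A \<le> int (card D) * (int (card D) - 1)"
    using \<open>A \<ge> 0\<close> by (intro mult_mono) auto
  then have A: "A * A * (int q - 1)\<^sup>2 \<le> int (card D) * (int (card D) - 1) * (int q - 1)\<^sup>2"
    by (intro mult_right_mono) auto
  \<comment> \<open>For \<open>q > 2\<close> it suffices that \<open>2 * q <= (q - 1) ^ 4\<close>
    and \<open>q <= X\<close>; for \<open>q = 2\<close> it says \<open>16 <= X ^ 2\<close>, with
    equality at \<open>r = 3\<close>.\<close>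
  have "2 * int q ^ 3 \<le> (int q - 1) ^ 4 * X\<^sup>2"
  proof (cases "q > 2")
    case True
    define t where "t = int q - 1"
    have t: "t \<ge> 2" using True by (simp add: t_def)
    then have "2 ^ 3 * t \<le> t ^ 3 * t" by (intro mult_right_mono power_mono) auto
    then have "2 * int q \<le> t ^ 4" using t by (simp add: t_def eval_nat_numeral)
    moreover have "(int q)\<^sup>2 \<le> X\<^sup>2" using X_ge by (intro power_mono) auto
    ultimately have "2 * int q * (int q)\<^sup>2 \<le> t ^ 4 * X\<^sup>2" by (intro mult_mono) auto
    then show ?thesis by (simp add: t_def eval_nat_numeral)
  next
    case False
    then have q: "q = 2" "r > 2" using assms q_ge_2 by auto
    then have "4 \<le> X" using power_increasing[of 2 "r - 1" "2 :: int"] by simp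
    then have "4\<^sup>2 \<le> X\<^sup>2" by (intro power_mono) auto
    then show ?thesis using q(1) by simp
  qed
  then have "2 * int q ^ 3 * X\<^sup>2 \<le> (int q - 1) ^ 4 * X\<^sup>2 * X\<^sup>2"
    by (intro mult_right_mono) auto
  also have "\<dots> = A * A * (int q - 1)\<^sup>2"
    by (simp add: A_def eval_nat_numeral mult_ac)
  also have "2 * int q ^ 3 * X\<^sup>2 = 2 * int q ^ (2 * r + 1)"
    unfolding power_add q_power_2r by (simp add: eval_nat_numeral mult_ac)
  finally have "2 * int q ^ (2 * r + 1) \<le> int (card D) * (int (card D) - 1) * (int q - 1)\<^sup>2"
    using A by linarith
  from sphere_packing_rules_out_5[OF q_ge_2 card_dual_C(1) this] show ?thesis by simp
qed

lemma dual_of_q_gt_2: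
  assumes "q > 2"
  shows "code_params F q D (dual_code F D C) (card D) (card D - 2 * r - 1) 3
    \<and> sphere_packing_rules_out q (card D) (card D - 2 * r - 1) 5"
  using assms code_params_dual[OF min_dist_dual_3] sphere_packing_dual by blast

lemma dual_of_q_eq_2:
  assumes "q = 2 \<and> r > 2"
  shows "code_params F q D (dual_code F D C) (card D) (card D - 2 * r - 1) 4
    \<and> sphere_packing_rules_out q (card D) (card D - 2 * r - 1) 5"
  using assms code_params_dual[OF min_dist_dual_4] sphere_packing_dual by blast

end

theorem theorem3p6:
  fixes p e q r m :: nat
    and D :: "'a::{field,finite} set"
    and C :: "('a \<Rightarrow> 'a) set"
  assumes "prime p" and "e \<ge> 1" and "q = p ^ e"
    and "r \<ge> 2" and "m = 2 * r"
    and "card (UNIV :: 'a set) = q ^ m"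
    and "D = {x. trace q r (x ^ (q ^ r + 1)) = 0}"
    and "C = {(\<lambda>x. if x \<in> D then trace q m (b * x) + c else 0) | b c.
                c \<in> subfield_of_order q}"
  shows "code_params (subfield_of_order q) q D C
           (q ^ (r - 1) * (q ^ r - q + 1)) (m + 1)
           (q ^ (r - 1) * (q ^ r - q ^ (r - 1) - q + 1))
     \<and> (\<forall>w::nat. int (card {v \<in> C. hweight D v = w}) =
          (if int w = 0 then 1 else 0)
        + (if int w = int q ^ (r - 1) * (int q ^ r - int q ^ (r - 1) - int q + 1)
           then int q ^ (r - 1) * (2 * int q ^ (r + 1) - 2 * int q ^ r - int q ^ 2 + 3 * int q - 2)
                - int q + 1 else 0)
        + (if int w = int q ^ (r - 1) * (int q ^ r - int q ^ (r - 1) - int q + 2)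
           then int q ^ (r - 1) * (int q - 1) * (int q ^ (r + 1) - int q ^ r + int q - 1) else 0)
        + (if int w = int q ^ (2 * r - 2) * (int q - 1)
           then int q ^ (r - 1) * (int q ^ r - int q + 1) - 1 else 0)
        + (if int w = int q ^ (r - 1) * (int q ^ r - int q + 1)
           then int q - 1 else 0))
     \<and> (q > 2 \<longrightarrow>
          (let n = q ^ (r - 1) * (q ^ r - q + 1) in
            code_params (subfield_of_order q) q D (dual_code (subfield_of_order q) D C)
              n (n - m - 1) 3
            \<and> sphere_packing_rules_out q n (n - m - 1) (3 + 2)))
     \<and> (q = 2 \<and> r > 2 \<longrightarrow>
          (let n = q ^ (r - 1) * (q ^ r - q + 1) in
            code_params (subfield_of_order q) q D (dual_code (subfield_of_order q) D C)
              n (n - m - 1) 4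
            \<and> sphere_packing_rules_out q n (n - m - 1) (4 + 1)))"
proof -
  interpret trace_norm_quadric q r "TYPE('a)"
    using assms by unfold_locales auto
  have eqD: "D = trace_norm_quadric.D q r"
    unfolding assms(7) D_def Q_def by (rule refl)
  have eqC: "C = trace_norm_quadric.C q r"
    unfolding assms(8) C_def cw_def T_def eqD[symmetric] assms(5) by (rule refl)
  \<comment> \<open>Almost optimality at distance 3 and optimality at distance 4 both exclude
    distance 5, so one estimate serves both.\<close>
  have sum5: "3 + 2 = (5::nat)" "4 + 1 = (5::nat)" by simp_all
  show ?thesis
    unfolding eqD eqC assms(5) Let_def card_D[symmetric] sum5
    using code_params_C[folded card_D] weight_distribution_C
      dual_of_q_gt_2 dual_of_q_eq_2 by blast
qed

end
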